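(* Let $\Gamma$ be a finite connected graph and $\rho$ a (flat unitary complex) line bundle on $\Gamma$ with $H_0(\Gamma;\rho)=0$. Then $$\det\bigl(\partial\partial^*\colon C_0(\Gamma;\rho)\to C_0(\Gamma;\rho)\bigr)=\sum_T\hat\rho_T ,$$ where $T$ ranges over all $\rho$-spanning trees of $\Gamma$.
   Context: Graphs. A graph $\Gamma$ is a one-dimensional CW complex with vertex set $\Gamma_0$ and edge set $\Gamma_1$; it is given by a map $(d_0,d_1)\colon\Gamma_1\to\Gamma_0\times\Gamma_0$ sending an (oriented) edge to its initial and terminal endpoints. Loop edges ($d_0(b)=d_1(b)$) and multiple edges are allowed. For a subcomplex $A\subset\Gamma$, $A_0,A_1$ denote its vertices and edges. A circuit is a simple closed path (a loop edge, or two parallel edges, may form a circuit). Line bundle and holonomy. After choosing unit vectors in the fibers, a (flat unitary complex) line bundle $\rho$ on $\Gamma$ is a function $\Gamma_1\to U(1)$, $b\mapsto\rho_b$. For an oriented circuit $C$, the holonomy is $\rho_C=\prod_{b\in C_1}\rho_b^{s_b}$, where $s_b=1$ if the orientation of $b$ agrees with that of $C$ and $s_b=-1$ otherwise. Write $z^*$ for the complex conjugate of $z\in\mathbb{C}$. If $A\subset\Gamma$ is a subgraph each of whose connected components $A_\alpha$ has Euler characteristic zero, then each $A_\alpha$ has a unique circuit $C_\alpha$; orienting these arbitrarily, set $\hat\rho_A=\prod_\alpha(\rho_{C_\alpha}-1)(\rho_{C_\alpha}^*-1)$, a real number independent of the orientations. Twisted chains. $C_i(\Gamma;\rho)$ ($i=0,1$)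 is the complex vector space with basis $\Gamma_i$, and $\partial\colon C_1(\Gamma;\rho)\to C_0(\Gamma;\rho)$ is the linear map with $\partial b=\rho_b\,d_0(b)-d_1(b)$. $H_*(\Gamma;\rho)$ is the homology of this complex, so $H_1(\Gamma;\rho)=\ker\partial$ and $H_0(\Gamma;\rho)=\operatorname{coker}\partial$. The same definitions apply to subcomplexes of $\Gamma$, with $\rho$ restricted. Adjoint. $\partial^*\colon C_0(\Gamma;\rho)\to C_1(\Gamma;\rho)$ is the adjoint of $\partial$ with respect to the standard Hermitian inner products, i.e. those making $\Gamma_0$ and $\Gamma_1$ orthonormal bases. $\rho$-spanning trees. A $\rho$-spanning tree is a subcomplex $T\subset\Gamma$ with $T_0=\Gamma_0$, $H_1(T;\rho)=0$, and such that the inclusion induces an isomorphism $H_0(T;\rho)\to H_0(\Gamma;\rho)$. (Under the assumption $H_0(\Gamma;\rho)=0$, every component of a $\rho$-spanning tree has Euler characteristic zero, so $\hat\rho_T$ is defined.) *)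

theory Defs
  imports "Jordan_Normal_Form.Determinant" "HOL-Library.Countable_Set" "Graph_Theory.Graph_Theory"
begin

text \<open>
  Graphs are the (loop- and multi-arc-friendly) digraphs of \<^theory>\<open>Graph_Theory.Digraph\<close>: the
  direction of an arc \<open>b\<close> is its reference orientation, with \<open>d\<^sub>0(b) = tail G b\<close> and
  \<open>d\<^sub>1(b) = head G b\<close>.  Subcomplexes are given by \<^const>\<open>subgraph\<close>, which leaves
  \<^const>\<open>tail\<close> and \<^const>\<open>head\<close> unchanged.
\<close>

definition line_bundle :: "('v, 'e) pre_digraph \<Rightarrow> ('e \<Rightarrow> complex) \<Rightarrow> bool" where
  "line_bundle G \<rho> \<longleftrightarrow> (\<forall>b \<in> arcs G. cmod (\<rho> b) = 1)"

section \<open>Twisted chains and homology\<close>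

text \<open>
  The complex vector space with basis \<open>S\<close>, as functions vanishing off \<open>S\<close>.  Chains of a subcomplex
  are then literally chains of the ambient graph, so inclusions act as the identity.
\<close>

definition chains :: "'a set \<Rightarrow> ('a \<Rightarrow> complex) set" where
  "chains S = {x. \<forall>s. s \<notin> S \<longrightarrow> x s = 0}"

abbreviation chains0 :: "('v, 'e) pre_digraph \<Rightarrow> ('v \<Rightarrow> complex) set" where
  "chains0 G \<equiv> chains (verts G)"

abbreviation chains1 :: "('v, 'e) pre_digraph \<Rightarrow> ('e \<Rightarrow> complex) set" where
  "chains1 G \<equiv> chains (arcs G)"

definition basis_chain :: "'a \<Rightarrow> 'a \<Rightarrow> complex" where
  "basis_chain s = (\<lambda>t. if t = s then 1 else 0)"

definition boundary ::
  "('v, 'e) pre_digraph \<Rightarrow> ('e \<Rightarrow> complex) \<Rightarrow> ('e \<Rightarrow> complex) \<Rightarrow> ('v \<Rightarrow> complex)" where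
  "boundary G \<rho> x =
     (\<lambda>v. \<Sum>b\<in>arcs G. x b * (\<rho> b * basis_chain (tail G b) v - basis_chain (head G b) v))"

definition H1 :: "('v, 'e) pre_digraph \<Rightarrow> ('e \<Rightarrow> complex) \<Rightarrow> ('e \<Rightarrow> complex) set" where
  "H1 G \<rho> = {x \<in> chains1 G. boundary G \<rho> x = (\<lambda>_. 0)}"

definition homologous ::
  "('v, 'e) pre_digraph \<Rightarrow> ('e \<Rightarrow> complex) \<Rightarrow> (('v \<Rightarrow> complex) \<times> ('v \<Rightarrow> complex)) set" where
  "homologous G \<rho> = {(x, y). x \<in> chains0 G \<and> y \<in> chains0 G \<and>
                              (\<lambda>v. x v - y v) \<in> boundary G \<rho> ` chains1 G}"

definition H0 :: "('v, 'e) pre_digraph \<Rightarrow> ('e \<Rightarrow> complex) \<Rightarrow> ('v \<Rightarrow> complex) set set" where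
  "H0 G \<rho> = chains0 G // homologous G \<rho>"

definition H1_zero :: "('v, 'e) pre_digraph \<Rightarrow> ('e \<Rightarrow> complex) \<Rightarrow> bool" where
  "H1_zero G \<rho> \<longleftrightarrow> H1 G \<rho> = {\<lambda>_. 0}"

definition H0_zero :: "('v, 'e) pre_digraph \<Rightarrow> ('e \<Rightarrow> complex) \<Rightarrow> bool" where
  "H0_zero G \<rho> \<longleftrightarrow> H0 G \<rho> = {homologous G \<rho> `` {\<lambda>_. 0}}"

text \<open>
  For a subgraph \<open>T\<close> of \<open>G\<close>, the map \<open>H\<^sub>0(T;\<rho>) \<rightarrow> H\<^sub>0(G;\<rho>)\<close> induced by inclusion: the class of \<open>x\<close>
  modulo boundaries of \<open>T\<close> goes to the class of \<open>x\<close> modulo boundaries of \<open>G\<close>.  It is induced by an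
  inclusion of vector spaces, hence linear, so it is an isomorphism iff it is bijective.
\<close>

definition H0_incl ::
  "('v, 'e) pre_digraph \<Rightarrow> ('e \<Rightarrow> complex) \<Rightarrow> ('v \<Rightarrow> complex) set \<Rightarrow> ('v \<Rightarrow> complex) set" where
  "H0_incl G \<rho> X = homologous G \<rho> `` X"

definition rho_spanning_tree ::
  "('v, 'e) pre_digraph \<Rightarrow> ('e \<Rightarrow> complex) \<Rightarrow> ('v, 'e) pre_digraph \<Rightarrow> bool" where
  "rho_spanning_tree G \<rho> T \<longleftrightarrow>
     subgraph T G \<and> verts T = verts G \<and> H1_zero T \<rho> \<and>
     bij_betw (H0_incl G \<rho>) (H0 T \<rho>) (H0 G \<rho>)"

section \<open>Adjoint and determinant\<close>

definition herm_inner :: "'a set \<Rightarrow> ('a \<Rightarrow> complex) \<Rightarrow> ('a \<Rightarrow> complex) \<Rightarrow> complex" where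
  "herm_inner S x y = (\<Sum>s\<in>S. x s * cnj (y s))"

definition boundary_adj ::
  "('v, 'e) pre_digraph \<Rightarrow> ('e \<Rightarrow> complex) \<Rightarrow> ('v \<Rightarrow> complex) \<Rightarrow> ('e \<Rightarrow> complex)" where
  "boundary_adj G \<rho> y =
     (THE x. x \<in> chains1 G \<and>
        (\<forall>z \<in> chains1 G. herm_inner (verts G) (boundary G \<rho> z) y = herm_inner (arcs G) z x))"

text \<open>
  The determinant of a linear endomorphism of \<^term>\<open>chains S\<close> for finite \<open>S\<close>, through its matrix in
  the basis \<open>S\<close>; \<^term>\<open>from_nat_into S\<close> enumerates \<open>S\<close> by \<open>{..<card S}\<close>, and the value does not
  depend on the enumeration.
\<close>

definition endo_det :: "'a set \<Rightarrow> (('a \<Rightarrow> complex) \<Rightarrow> ('a \<Rightarrow> complex)) \<Rightarrow> complex" where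
  "endo_det S L =
     det (mat (card S) (card S)
       (\<lambda>(i, j). L (basis_chain (from_nat_into S j)) (from_nat_into S i)))"

section \<open>Circuits and holonomy\<close>

text \<open>
  \<open>(b, True)\<close> is the arc \<open>b\<close> with its reference orientation, \<open>(b, False)\<close> is \<open>b\<close> reversed.
\<close>

definition oriented_double :: "('v, 'e) pre_digraph \<Rightarrow> ('v, 'e \<times> bool) pre_digraph" where
  "oriented_double G =
     \<lparr> verts = verts G, arcs = arcs G \<times> UNIV,
       tail = (\<lambda>(b, s). if s then tail G b else head G b),
       head = (\<lambda>(b, s). if s then head G b else tail G b) \<rparr>"

text \<open>
  Distinctness of the underlying arcs excludes the backtracking walk along \<open>b\<close> and back, which is
  a directed \<^const>\<open>pre_digraph.cycle\<close> of the doubled graph but not a circuit.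
\<close>

definition oriented_circuit :: "('v, 'e) pre_digraph \<Rightarrow> ('e \<times> bool) list \<Rightarrow> bool" where
  "oriented_circuit G p \<longleftrightarrow> pre_digraph.cycle (oriented_double G) p \<and> distinct (map fst p)"

definition holonomy :: "('e \<Rightarrow> complex) \<Rightarrow> ('e \<times> bool) list \<Rightarrow> complex" where
  "holonomy \<rho> p = (\<Prod>(b, s)\<leftarrow>p. \<rho> b powi (if s then 1 else -1))"

definition components :: "('v, 'e) pre_digraph \<Rightarrow> ('v, 'e) pre_digraph set" where
  "components A = {K. pre_digraph.max_subgraph A Digraph_Component.connected K}"

text \<open>
  Meaningful when every component of \<open>A\<close> has Euler characteristic zero, hence a unique circuit.
  The choice by \<open>SOME\<close> is one of starting point and orientation of that circuit; the factor does
  not depend on it, since reversing the orientation conjugates the holonomy.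
\<close>

definition rho_hat :: "('e \<Rightarrow> complex) \<Rightarrow> ('v, 'e) pre_digraph \<Rightarrow> complex" where
  "rho_hat \<rho> A =
     (\<Prod>K\<in>components A.
        let h = holonomy \<rho> (SOME p. oriented_circuit K p) in (h - 1) * (cnj h - 1))"

end

theory Submission
  imports Defs
begin

text \<open>
  Write \<open>M\<close> for the matrix of \<open>\<partial>\<close> in the bases of arcs and vertices.  The matrix of \<open>\<partial>\<partial>\<^sup>*\<close> is the
  product of \<open>M\<close> with its conjugate transpose, so the Cauchy-Binet formula expands the determinant
  as the sum of \<open>\<bar>det M\<^sub>S\<bar>\<^sup>2\<close> over the sets \<open>S\<close> of arcs with as many elements as there are vertices,
  where \<open>M\<^sub>S\<close> consists of the columns in \<open>S\<close> (\<open>endo_det_laplacian\<close>).  Since \<open>H\<^sub>0(G;\<rho>) = 0\<close>, a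
  spanning subgraph \<open>T\<close> with arc set \<open>S\<close> is a \<open>\<rho>\<close>-spanning tree iff its boundary map is bijective,
  that is, iff \<open>S\<close> has the right size and \<open>det M\<^sub>S \<noteq> 0\<close> (\<open>rho_spanning_tree_iff\<close>).  So everything
  comes down to \<open>\<bar>det M\<^sub>S\<bar>\<^sup>2 = \<rho>\<^sub>T\<close> for these \<open>T\<close> (\<open>minor_incidence\<close>), where \<open>\<rho>\<^sub>T\<close> is the product of
  the factors \<open>(h - 1)(h\<^sup>* - 1)\<close> over the components.

  For this, a nonzero term of the Leibniz expansion of \<open>det M\<^sub>S\<close> is a bijection \<open>f\<close> that assigns to
  every vertex an incident arc.  Walking from \<open>v\<close> along \<open>f v\<close> is a self-map of the vertex set, and
  up to factors of modulus 1 the matrix \<open>M\<^sub>S\<close> becomes \<open>1 - N\<close>, where column \<open>v\<close> of \<open>N\<close> has one entry,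
  a weight of modulus 1, in the row of the successor of \<open>v\<close>.  Column operations along the cycles of
  the self-map make \<open>1 - N\<close> triangular, and its determinant is the product of \<open>1 - \<omega>\<close> over the cycles,
  \<open>\<omega>\<close> being the product of the weights on the cycle (\<open>minor_functional\<close>).  Every arc of \<open>T\<close> joins
  some \<open>v\<close> to its successor, so the components of \<open>T\<close> correspond to the cycles of the self-map.
  Moreover a circuit of \<open>T\<close> has as many arcs as vertices, which forces it to run along such a cycle,
  forwards or backwards (\<open>circuit_is_orbit\<close>).  Hence \<open>\<omega>\<close> is the holonomy of that circuit or its
  inverse, and in both cases \<open>\<bar>1 - \<omega>\<bar>\<^sup>2 = (h - 1)(h\<^sup>* - 1)\<close>.
\<close>

section \<open>Minors indexed by finite sets and the Cauchy-Binet formula\<close>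

text \<open>
  Rows and columns are listed by \<^const>\<open>from_nat_into\<close>, as in \<^const>\<open>endo_det\<close>.  Only the case
  \<open>card R = card C\<close> is meaningful; then changing the listings changes the value at most by a sign,
  and not at all if \<open>R = C\<close>.
\<close>

definition minor :: "('a \<Rightarrow> 'b \<Rightarrow> 'c::comm_ring_1) \<Rightarrow> 'a set \<Rightarrow> 'b set \<Rightarrow> 'c" where
  "minor A R C =
     det (mat (card R) (card R) (\<lambda>(i, j). A (from_nat_into R i) (from_nat_into C j)))"

lemma from_nat_into_bij:
  assumes "finite S"
  shows "bij_betw (from_nat_into S) {0..<card S} S"
  using bij_betw_from_nat_into_finite[OF assms] by (simp add: atLeast0LessThan)

lemma from_nat_into_memb:
  assumes "finite S" "i < card S"
  shows "from_nat_into S i \<in> S"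
  using from_nat_into_bij[OF assms(1)] assms(2) unfolding bij_betw_def by auto

lemma from_nat_into_eq_iff:
  assumes "finite S" "i < card S" "j < card S"
  shows "from_nat_into S i = from_nat_into S j \<longleftrightarrow> i = j"
  using from_nat_into_bij[OF assms(1)] assms(2-) unfolding bij_betw_def inj_on_def by auto

lemma minor_leibniz:
  "minor A R C = (\<Sum>p | p permutes {0..<card R}.
     signof p * (\<Prod>i = 0..<card R. A (from_nat_into R i) (from_nat_into C (p i))))"
proof -
  have "p i < card R" if "p permutes {0..<card R}" "i < card R" for p i
    using permutes_in_image[OF that(1), of i] that(2) by simp
  then show ?thesis
    unfolding minor_def by (subst det_def'[of _ "card R"]) (auto intro!: sum.cong prod.cong)
qed

lemma minor_cong:
  assumes "finite R" "finite C" "card R = card C"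
    and "\<And>x y. x \<in> R \<Longrightarrow> y \<in> C \<Longrightarrow> A x y = B x y"
  shows "minor A R C = minor B R C"
proof -
  have "A (from_nat_into R i) (from_nat_into C j) = B (from_nat_into R i) (from_nat_into C j)"
    if "i < card R" "j < card R" for i j
    using that assms(3)
    by (intro assms(4) from_nat_into_memb[OF assms(1)] from_nat_into_memb[OF assms(2)]) auto
  then show ?thesis
    unfolding minor_def by (intro arg_cong[where f = det] eq_matI) auto
qed

lemma minor_transpose:
  assumes "card R = card C"
  shows "minor A R C = minor (\<lambda>c r. A r c) C R"
proof -
  have "transpose_mat (mat (card R) (card R) (\<lambda>(i, j). A (from_nat_into R i) (from_nat_into C j)))
     = mat (card C) (card C) (\<lambda>(i, j). A (from_nat_into R j) (from_nat_into C i))"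
    using assms by (intro eq_matI) auto
  then show ?thesis
    unfolding minor_def by (metis det_transpose mat_carrier)
qed

text \<open>
  The matching is read off from a nonzero term of the Leibniz expansion.
\<close>

lemma minor_neq_0_imp_matching:
  assumes "finite R" "finite C" "card R = card C" "minor A R C \<noteq> 0"
  obtains f where "bij_betw f R C" "\<And>x. x \<in> R \<Longrightarrow> A x (f x) \<noteq> 0"
proof -
  let ?n = "card R" and ?r = "from_nat_into R" and ?c = "from_nat_into C"
  from assms(4) obtain p where p: "p permutes {0..<?n}"
    and "signof p * (\<Prod>i = 0..<?n. A (?r i) (?c (p i))) \<noteq> 0"
    unfolding minor_leibniz by (auto elim!: sum.not_neutral_contains_not_neutral)
  then have prod: "(\<Prod>i = 0..<?n. A (?r i) (?c (p i))) \<noteq> 0"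
    by auto
  have nz: "A (?r i) (?c (p i)) \<noteq> 0" if "i < ?n" for i
  proof
    assume "A (?r i) (?c (p i)) = 0"
    moreover have "(\<Prod>i = 0..<?n. A (?r i) (?c (p i)))
        = A (?r i) (?c (p i)) * (\<Prod>i \<in> {0..<?n} - {i}. A (?r i) (?c (p i)))"
      using that by (intro prod.remove) auto
    ultimately show False
      using prod by simp
  qed
  define f where "f = ?c \<circ> p \<circ> inv_into {0..<?n} ?r"
  have r: "bij_betw ?r {0..<?n} R" and c: "bij_betw ?c {0..<?n} C"
    using from_nat_into_bij[OF assms(1)] from_nat_into_bij[OF assms(2)] assms(3) by simp_all
  have "bij_betw f R C"
    unfolding f_def
    using bij_betw_trans[OF bij_betw_inv_into[OF r] bij_betw_trans[OF permutes_imp_bij[OF p] c]]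
    by (simp add: comp_assoc)
  moreover have "A x (f x) \<noteq> 0" if "x \<in> R" for x
  proof -
    have "x \<in> ?r ` {0..<?n}"
      using bij_betw_imp_surj_on[OF r] that by simp
    then obtain i where "i < ?n" "x = ?r i"
      by auto
    moreover from this have "inv_into {0..<?n} ?r x = i"
      using r by (simp add: bij_betw_inv_into_left)
    ultimately show ?thesis
      using nz by (simp add: f_def)
  qed
  ultimately show thesis
    using that by blast
qed

text \<open>
  A permutation that contributes to the Leibniz expansion never decreases the rank and keeps the
  sum of all ranks, hence fixes every index.  Since \<open>rank\<close> may have ties, the
  rows and columns need no sorting.
\<close>

lemma minor_triangular:
  fixes rank :: "'a \<Rightarrow> nat"
  assumes V: "finite V"
    and tri: "\<And>u v. u \<in> V \<Longrightarrow> v \<in> V \<Longrightarrow> u \<noteq> v \<Longrightarrow> A u v \<noteq> 0 \<Longrightarrow> rank u < rank v"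
  shows "minor A V V = (\<Prod>v\<in>V. A v v)"
proof -
  let ?I = "{0..<card V}" and ?e = "from_nat_into V"
  have zero: "(\<Prod>i\<in>?I. A (?e i) (?e (p i))) = 0" if p: "p permutes ?I" and "p \<noteq> id" for p
  proof (rule ccontr)
    assume nz: "(\<Prod>i\<in>?I. A (?e i) (?e (p i))) \<noteq> 0"
    have lt: "rank (?e i) < rank (?e (p i))" if "i \<in> ?I" "p i \<noteq> i" for i
    proof (rule tri)
      have pi: "p i \<in> ?I"
        using p that by (simp add: permutes_in_image)
      show "?e i \<in> V" "?e (p i) \<in> V"
        using from_nat_into_memb[OF V] that pi by auto
      show "?e i \<noteq> ?e (p i)"
        using from_nat_into_eq_iff[OF V, of i "p i"] that pi by auto
      show "A (?e i) (?e (p i)) \<noteq> 0"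
      proof
        assume "A (?e i) (?e (p i)) = 0"
        then have "(\<Prod>i\<in>?I. A (?e i) (?e (p i))) = 0"
          using prod.remove[of ?I i "\<lambda>i. A (?e i) (?e (p i))"] that(1) by simp
        with nz show False by simp
      qed
    qed
    obtain k where k: "p k \<noteq> k"
      using \<open>p \<noteq> id\<close> by (metis eq_id_iff)
    then have "k \<in> ?I"
      using p permutes_not_in by metis
    have "(\<Sum>i\<in>?I. rank (?e i)) < (\<Sum>i\<in>?I. rank (?e (p i)))"
    proof (rule sum_strict_mono_ex1)
      show "\<forall>i\<in>?I. rank (?e i) \<le> rank (?e (p i))"
        using lt by (metis less_imp_le order_refl)
      show "\<exists>i\<in>?I. rank (?e i) < rank (?e (p i))"
        using lt k \<open>k \<in> ?I\<close> by blast
    qed auto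
    moreover have "(\<Sum>i\<in>?I. rank (?e (p i))) = (\<Sum>i\<in>?I. rank (?e i))"
      using sum.permute[OF p, of "\<lambda>i. rank (?e i)"] by (simp add: comp_def)
    ultimately show False by simp
  qed
  have "minor A V V = (\<Sum>p | p permutes ?I. if p = id then \<Prod>i\<in>?I. A (?e i) (?e i) else 0)"
    unfolding minor_leibniz by (intro sum.cong) (auto simp: zero)
  also have "\<dots> = (\<Prod>i\<in>?I. A (?e i) (?e i))"
    by (simp add: sum.delta finite_permutations permutes_id)
  also have "\<dots> = (\<Prod>v\<in>V. A v v)"
    using prod.reindex_bij_betw[OF from_nat_into_bij[OF V], of "\<lambda>v. A v v"] .
  finally show ?thesis .
qed

text \<open>
  Multiplying out the entries of the product gives a sum over all maps \<open>\<phi>\<close> from the row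
  indices to \<open>E\<close>, in which \<open>\<phi>\<close> contributes the determinant formed by the rows \<open>\<phi> i\<close> of \<open>B\<close>.  It
  vanishes unless \<open>\<phi>\<close> is injective, and the injective maps with image \<open>S\<close> are the permutations
  of \<open>S\<close>, which reassemble the two minors at \<open>S\<close>.
\<close>

theorem cauchy_binet:
  assumes V: "finite V" and E: "finite E"
  shows "minor (\<lambda>u v. \<Sum>b\<in>E. A u b * B b v) V W =
    (\<Sum>S | S \<subseteq> E \<and> card S = card V. minor A V S * minor B S W)"
proof -
  let ?n = "card V" and ?e = "from_nat_into V" and ?d = "from_nat_into W"
  let ?I = "{0..<?n}"
  let ?s = "\<lambda>S. from_nat_into S"
  define D where "D \<phi> = det (mat ?n ?n (\<lambda>(i, j). B (\<phi> i) (?d j)))" for \<phi>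
  define X where "X \<phi> = (\<Prod>i\<in>?I. A (?e i) (\<phi> i)) * D \<phi>" for \<phi>
  define F where "F = {\<phi> \<in> ?I \<rightarrow>\<^sub>E E. inj_on \<phi> ?I}"
  have D_leibniz: "D \<phi> = (\<Sum>p | p permutes ?I. signof p * (\<Prod>i\<in>?I. B (\<phi> i) (?d (p i))))" for \<phi>
  proof -
    have "p i < ?n" if "p permutes ?I" "i < ?n" for p i
      using permutes_in_image[OF that(1), of i] that(2) by simp
    then show ?thesis
      unfolding D_def by (subst det_def'[of _ ?n]) (auto intro!: sum.cong prod.cong)
  qed
  have D_0: "D \<phi> = 0" if "\<not> inj_on \<phi> ?I" for \<phi>
  proof -
    obtain i j where ij: "i < ?n" "j < ?n" "i \<noteq> j" "\<phi> i = \<phi> j"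
      using \<open>\<not> inj_on \<phi> ?I\<close> by (auto simp: inj_on_def)
    show ?thesis
      unfolding D_def
      by (rule det_identical_rows[of _ ?n i j]) (use ij in \<open>auto intro!: eq_vecI\<close>)
  qed
  have finF: "finite (?I \<rightarrow>\<^sub>E E)"
    using E by (intro finite_PiE) auto
  have "minor (\<lambda>u v. \<Sum>b\<in>E. A u b * B b v) V W
      = (\<Sum>p | p permutes ?I. signof p * (\<Sum>\<phi>\<in>?I \<rightarrow>\<^sub>E E. \<Prod>i\<in>?I. A (?e i) (\<phi> i) * B (\<phi> i) (?d (p i))))"
    unfolding minor_leibniz using E by (subst prod_sum_PiE) auto
  also have "\<dots> = (\<Sum>\<phi>\<in>?I \<rightarrow>\<^sub>E E. X \<phi>)"
    unfolding X_def D_leibniz sum_distrib_left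
    by (subst sum.swap) (intro sum.cong refl, simp add: prod.distrib mult_ac)
  also have "\<dots> = (\<Sum>\<phi>\<in>F. X \<phi>)"
    using finF by (intro sum.mono_neutral_right) (auto simp: F_def X_def D_0)
  also have "\<dots> = (\<Sum>S | S \<subseteq> E \<and> card S = ?n. \<Sum>\<phi> | \<phi> \<in> F \<and> \<phi> ` ?I = S. X \<phi>)"
    using E finF by (intro sum.group[symmetric]) (auto simp: F_def card_image)
  also have "\<dots> = (\<Sum>S | S \<subseteq> E \<and> card S = ?n. minor A V S * minor B S W)"
  proof (intro sum.cong refl)
    fix S assume "S \<in> {S. S \<subseteq> E \<and> card S = ?n}"
    then have S: "S \<subseteq> E" "card S = ?n" by auto
    then have finS: "finite S"
      using E finite_subset by auto
    have bij: "bij_betw (?s S) ?I S"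
      using from_nat_into_bij[OF finS] S by simp
    let ?\<phi> = "\<lambda>p. restrict (?s S \<circ> p) ?I"
    let ?p = "\<lambda>\<phi> i. if i \<in> ?I then inv_into ?I (?s S) (\<phi> i) else i"
    have "(\<Sum>\<phi> | \<phi> \<in> F \<and> \<phi> ` ?I = S. X \<phi>) = (\<Sum>p | p permutes ?I. X (?\<phi> p))"
    proof (rule sum.reindex_bij_witness[of _ ?\<phi> ?p])
      fix \<phi> assume "\<phi> \<in> {\<phi> \<in> F. \<phi> ` ?I = S}"
      then have \<phi>: "bij_betw \<phi> ?I S" "\<phi> \<in> extensional ?I"
        by (auto simp: F_def bij_betw_def PiE_def)
      have "bij_betw (inv_into ?I (?s S) \<circ> \<phi>) ?I ?I"
        using \<phi>(1) bij_betw_inv_into[OF bij] by (rule bij_betw_trans)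
      then have "bij_betw (?p \<phi>) ?I ?I"
        by (rule bij_betw_cong[THEN iffD1, rotated]) auto
      then show "?p \<phi> \<in> {p. p permutes ?I}"
        by (auto intro: bij_imp_permutes)
      have "?s S (inv_into ?I (?s S) (\<phi> i)) = \<phi> i" if "i \<in> ?I" for i
        using \<phi>(1) bij that by (metis bij_betw_inv_into_right bij_betwE)
      then show *: "?\<phi> (?p \<phi>) = \<phi>"
        using \<phi>(2) by (auto simp: fun_eq_iff extensional_def restrict_def)
      show "X (?\<phi> (?p \<phi>)) = X \<phi>" unfolding * ..
    next
      fix p assume "p \<in> {p. p permutes ?I}"
      then have p: "p permutes ?I" by simp
      have pI: "p i \<in> ?I" if "i \<in> ?I" for i
        using p that by (simp add: permutes_in_image)
      have b: "bij_betw (?\<phi> p) ?I S"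
        using bij_betw_trans[OF permutes_imp_bij[OF p] bij]
        by (rule bij_betw_cong[THEN iffD1, rotated]) auto
      then show "?\<phi> p \<in> {\<phi> \<in> F. \<phi> ` ?I = S}"
        using S by (auto simp: F_def bij_betw_def)
      have "inv_into ?I (?s S) (?s S (p i)) = p i" if "i \<in> ?I" for i
        using bij_betw_inv_into_left[OF bij pI[OF that]] .
      then show "?p (?\<phi> p) = p"
        using permutes_not_in[OF p] by (auto simp: fun_eq_iff)
    qed
    also have "\<dots> = (\<Sum>p | p permutes ?I.
        (signof p * (\<Prod>i\<in>?I. A (?e i) (?s S (p i)))) * minor B S W)"
    proof (intro sum.cong refl)
      fix p assume "p \<in> {p. p permutes ?I}"
      then have p: "p permutes ?I" by simp
      let ?M = "mat ?n ?n (\<lambda>(i, j). B (?s S i) (?d j))"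
      have "D (?\<phi> p) = det (mat ?n ?n (\<lambda>(i, j). ?M $$ (p i, j)))"
        unfolding D_def using permutes_in_image[OF p]
        by (intro arg_cong[where f = det] eq_matI) auto
      also have "\<dots> = signof p * minor B S W"
        unfolding minor_def S(2) by (rule det_permute_rows) (use p in auto)
      finally show "X (?\<phi> p) = signof p * (\<Prod>i\<in>?I. A (?e i) (?s S (p i))) * minor B S W"
        unfolding X_def by (simp add: mult_ac)
    qed
    also have "\<dots> = minor A V S * minor B S W"
      unfolding minor_leibniz[of A] sum_distrib_right ..
    finally show "(\<Sum>\<phi> | \<phi> \<in> F \<and> \<phi> ` ?I = S. X \<phi>) = minor A V S * minor B S W" .
  qed
  finally show ?thesis .
qed

corollary minor_mult:
  assumes "finite V" "finite E" "card E = card V"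
  shows "minor (\<lambda>u v. \<Sum>b\<in>E. A u b * B b v) V W = minor A V E * minor B E W"
proof -
  have "{S. S \<subseteq> E \<and> card S = card V} = {E}"
  proof (intro equalityI subsetI)
    fix S assume "S \<in> {S. S \<subseteq> E \<and> card S = card V}"
    then show "S \<in> {E}"
      using card_subset_eq[OF assms(2)] assms(3) by simp
  qed (use assms in simp)
  then show ?thesis
    using cauchy_binet[OF assms(1,2), of A B W] by simp
qed

lemma minor_identity:
  assumes "finite V"
  shows "minor (\<lambda>u v. if u = v then 1 else 0) V V = 1"
  using minor_triangular[OF assms, of "\<lambda>u v. if u = v then 1 else 0" "\<lambda>_. 0"] by simp

text \<open>
  The factor \<open>s\<close> is the sign that relates two listings of the columns.  It appears here as the
  minor of a permutation matrix, whose product with its transpose is the identity.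
\<close>

lemma minor_reindex_columns:
  fixes A :: "'a \<Rightarrow> 'b \<Rightarrow> 'c::comm_ring_1"
  assumes V: "finite V" and S: "finite S" and f: "bij_betw f V S"
  obtains s :: 'c where "s * s = 1" "minor (\<lambda>u v. A u (f v)) V V = minor A V S * s"
proof -
  define P :: "'b \<Rightarrow> 'a \<Rightarrow> 'c" where "P b v = (if b = f v then 1 else 0)" for b v
  have card: "card S = card V"
    using bij_betw_same_card[OF f] by simp
  have fS: "f v \<in> S" if "v \<in> V" for v
    using f that bij_betwE by auto
  have "minor (\<lambda>u v. A u (f v)) V V = minor (\<lambda>u v. \<Sum>b\<in>S. A u b * P b v) V V"
    using V S fS by (intro minor_cong) (auto simp: P_def if_distrib cong: if_cong)
  also have "\<dots> = minor A V S * minor P S V"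
    using V S card by (rule minor_mult)
  finally have 1: "minor (\<lambda>u v. A u (f v)) V V = minor A V S * minor P S V" .
  have "minor P S V * minor P S V = minor P S V * minor (\<lambda>v b. P b v) V S"
    using minor_transpose[of S V P] card by simp
  also have "\<dots> = minor (\<lambda>b c. \<Sum>v\<in>V. P b v * P c v) S S"
    using minor_mult[of S V P "\<lambda>v b. P b v" S] V S card by simp
  also have "\<dots> = minor (\<lambda>b c. if b = c then 1 else 0) S S"
  proof (intro minor_cong S refl)
    fix b c assume bc: "b \<in> S" "c \<in> S"
    then obtain v where v: "v \<in> V" "b = f v"
      using f by (auto simp: bij_betw_def)
    have eq: "f v = f x \<longleftrightarrow> v = x" if "x \<in> V" for x
      using f v that by (auto simp: bij_betw_def inj_on_def)
    have "(\<Sum>x\<in>V. P b x * P c x) = (\<Sum>x\<in>V. if v = x then P c v else 0)"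
      by (intro sum.cong) (auto simp: P_def v eq)
    also have "\<dots> = P c v"
      using v V by simp
    finally show "(\<Sum>x\<in>V. P b x * P c x) = (if b = c then 1 else 0)"
      by (auto simp: P_def v)
  qed
  also have "\<dots> = 1"
    by (rule minor_identity[OF S])
  finally show thesis
    using 1 that by blast
qed

section \<open>The determinant of a weighted self-map\<close>

text \<open>
  The set \<open>R\<close> contains exactly one vertex \<open>r\<close> of each cycle of \<open>nxt\<close>, and \<open>k r\<close> is the length of
  that cycle.  To column \<open>r\<close> of \<open>1 - N\<close> add the other columns of its cycle, each multiplied by the
  weights of the path leading to it from \<open>r\<close>: the sum telescopes to \<open>1 - \<omega>\<close> times the unit
  vector at \<open>r\<close>.  This column operation is right multiplication by a unitriangular matrix \<open>U\<close>.  The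
  resulting matrix \<open>D\<close> is triangular for the number of steps that a vertex is away from \<open>R\<close>.
\<close>

lemma minor_functional:
  fixes nxt :: "'v \<Rightarrow> 'v" and w :: "'v \<Rightarrow> 'c::comm_ring_1" and k :: "'v \<Rightarrow> nat"
  assumes V: "finite V" and R: "R \<subseteq> V"
    and nxt: "\<And>v. v \<in> V \<Longrightarrow> nxt v \<in> V"
    and reach: "\<And>v. v \<in> V \<Longrightarrow> \<exists>n. (nxt ^^ n) v \<in> R"
    and k: "\<And>r. r \<in> R \<Longrightarrow> 0 < k r"
    and period: "\<And>r. r \<in> R \<Longrightarrow> (nxt ^^ k r) r = r"
    and first: "\<And>r i. r \<in> R \<Longrightarrow> 0 < i \<Longrightarrow> i < k r \<Longrightarrow> (nxt ^^ i) r \<notin> R"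
  shows "minor (\<lambda>u v. (if u = v then 1 else 0) - (if u = nxt v then w v else 0)) V V =
    (\<Prod>r\<in>R. 1 - (\<Prod>i<k r. w ((nxt ^^ i) r)))"
proof -
  define c where "c r i = (\<Prod>j<i. w ((nxt ^^ j) r))" for r i
  define M where "M u v = (if u = v then 1 else 0) - (if u = nxt v then w v else 0)" for u v
  define U where "U u v =
    (if v \<in> R then \<Sum>i<k v. if u = (nxt ^^ i) v then c v i else 0
     else if u = v then 1 else 0)" for u v
  define D where "D u v = (if v \<in> R then if u = v then 1 - c v (k v) else 0 else M u v)" for u v
  define d where "d v = (LEAST n. (nxt ^^ n) v \<in> R)" for v
  have pow: "(nxt ^^ i) v \<in> V" if "v \<in> V" for i v
    using that by (induction i) (simp_all add: nxt)
  have MU: "(\<Sum>x\<in>V. M u x * U x v) = D u v" if "u \<in> V" "v \<in> V" for u v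
  proof (cases "v \<in> R")
    case True
    let ?t = "\<lambda>i. if u = (nxt ^^ i) v then c v i else 0"
    have "(\<Sum>x\<in>V. M u x * U x v)
        = (\<Sum>i<k v. \<Sum>x\<in>V. if x = (nxt ^^ i) v then M u x * c v i else 0)"
      unfolding U_def if_P[OF True] sum_distrib_left
      by (subst sum.swap) (intro sum.cong refl, simp)
    also have "\<dots> = (\<Sum>i<k v. M u ((nxt ^^ i) v) * c v i)"
      using V pow[OF \<open>v \<in> V\<close>] by (simp add: sum.delta)
    also have "\<dots> = (\<Sum>i<k v. ?t i - ?t (Suc i))"
      by (intro sum.cong refl) (simp add: M_def c_def algebra_simps)
    also have "\<dots> = ?t 0 - ?t (k v)"
      by (rule sum_lessThan_telescope')
    also have "\<dots> = D u v"
      using True period by (auto simp: D_def c_def)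
    finally show ?thesis .
  next
    case False
    then have "(\<Sum>x\<in>V. M u x * U x v) = (\<Sum>x\<in>V. if x = v then M u x else 0)"
      by (intro sum.cong) (auto simp: U_def)
    also have "\<dots> = D u v"
      using V \<open>v \<in> V\<close> False by (simp add: D_def)
    finally show ?thesis .
  qed
  have "minor U V V = (\<Prod>v\<in>V. U v v)"
  proof (rule minor_triangular[OF V, where rank = "\<lambda>v. if v \<in> R then 1 else 0"])
    fix u v assume uv: "u \<in> V" "v \<in> V" "u \<noteq> v" "U u v \<noteq> 0"
    then have "v \<in> R"
      by (auto simp: U_def split: if_splits)
    with uv have "(\<Sum>i<k v. if u = (nxt ^^ i) v then c v i else 0) \<noteq> 0"
      by (simp add: U_def)
    then obtain i where "i < k v" "u = (nxt ^^ i) v"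
      by (auto elim!: sum.not_neutral_contains_not_neutral split: if_splits)
    moreover from this \<open>u \<noteq> v\<close> have "0 < i"
      by (cases i) auto
    ultimately have "u \<notin> R"
      using first \<open>v \<in> R\<close> by blast
    then show "(if u \<in> R then 1 else 0) < (if v \<in> R then 1 else (0::nat))"
      using \<open>v \<in> R\<close> by simp
  qed
  also have "\<dots> = 1"
  proof (rule prod.neutral, rule ballI)
    fix v assume "v \<in> V"
    show "U v v = 1"
    proof (cases "v \<in> R")
      case True
      have "U v v = (\<Sum>i<k v. if i = 0 then 1 else 0)"
        unfolding U_def if_P[OF True]
      proof (intro sum.cong refl)
        fix i assume "i \<in> {..<k v}"
        then have "(nxt ^^ i) v \<noteq> v" if "i \<noteq> 0"
          using first[OF True, of i] that True by auto
        then show "(if v = (nxt ^^ i) v then c v i else 0) = (if i = 0 then 1 else 0)"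
          by (auto simp: c_def)
      qed
      then show ?thesis
        using k[OF True] by simp
    qed (simp add: U_def)
  qed
  finally have "minor U V V = 1" .
  have stay: "nxt v \<noteq> v" if "v \<in> V" "v \<notin> R" for v
  proof
    assume "nxt v = v"
    then have "(nxt ^^ n) v = v" for n
      by (induction n) auto
    then show False
      using reach that by metis
  qed
  have "minor D V V = (\<Prod>v\<in>V. D v v)"
  proof (rule minor_triangular[OF V, where rank = d])
    fix u v assume uv: "u \<in> V" "v \<in> V" "u \<noteq> v" "D u v \<noteq> 0"
    then have v: "v \<notin> R" and u: "u = nxt v"
      by (auto simp: D_def M_def split: if_splits)
    have R: "(nxt ^^ d v) v \<in> R"
      unfolding d_def using reach[OF uv(2)] by (rule LeastI_ex)
    then obtain n where n: "d v = Suc n"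
      using v by (cases "d v") auto
    with R have "(nxt ^^ n) u \<in> R"
      by (simp add: u funpow_swap1)
    then have "d u \<le> n"
      unfolding d_def by (rule Least_le)
    then show "d u < d v"
      using n by simp
  qed
  also have "\<dots> = (\<Prod>v\<in>R. D v v)"
  proof (rule prod.mono_neutral_right[OF V R], rule ballI)
    fix v assume "v \<in> V - R"
    then have "v \<noteq> nxt v"
      using stay[of v] by fastforce
    then show "D v v = 1"
      using \<open>v \<in> V - R\<close> by (simp add: D_def M_def)
  qed
  also have "\<dots> = (\<Prod>r\<in>R. 1 - (\<Prod>i<k r. w ((nxt ^^ i) r)))"
    by (intro prod.cong) (auto simp: D_def c_def)
  finally have D: "minor D V V = \<dots>" .
  have "minor D V V = minor (\<lambda>u v. \<Sum>x\<in>V. M u x * U x v) V V"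
    using V MU by (intro minor_cong) auto
  also have "\<dots> = minor M V V * minor U V V"
    using V by (intro minor_mult) auto
  finally show ?thesis
    using D \<open>minor U V V = 1\<close> by (simp add: M_def[abs_def])
qed

section \<open>Connected components\<close>

text \<open>
  Walks that ignore the orientation of the arcs are paths in the symmetric closure
  \<^term>\<open>mk_symmetric T\<close>.
\<close>

definition comp_of :: "('v, 'e) pre_digraph \<Rightarrow> 'v \<Rightarrow> ('v, 'e) pre_digraph" where
  "comp_of T v = T \<restriction> {u. (v, u) \<in> (parcs (mk_symmetric T))\<^sup>*}"

lemma connected_iff:
  assumes "wf_digraph K"
  shows "Digraph_Component.connected K \<longleftrightarrow>
    verts K \<noteq> {} \<and> (\<forall>u\<in>verts K. \<forall>v\<in>verts K. (u, v) \<in> (parcs (mk_symmetric K))\<^sup>*)"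
proof -
  interpret wf_digraph K by fact
  interpret S: pair_wf_digraph "mk_symmetric K" ..
  have "u \<rightarrow>\<^sup>*\<^bsub>mk_symmetric K\<^esub> v \<longleftrightarrow> (u, v) \<in> (parcs (mk_symmetric K))\<^sup>*" if "u \<in> verts K" for u v
    using S.reachable_conv'[of u v] that by simp
  then show ?thesis
    unfolding Digraph_Component.connected_def strongly_connected_def by auto
qed

lemma sym_symmetric_arcs: "sym ((parcs (mk_symmetric T))\<^sup>*)"
  by (intro sym_rtrancl symI) (auto simp: parcs_mk_symmetric)

lemma comp_of_verts:
  assumes "wf_digraph T" "v \<in> verts T" "u \<in> verts (comp_of T v)"
  shows "u \<in> verts T"
proof -
  interpret wf_digraph T by fact
  have "(v, u) \<in> (parcs (mk_symmetric T))\<^sup>*"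
    using assms(3) by (simp add: comp_of_def)
  then show ?thesis
    using assms(2) by induction (auto simp: parcs_mk_symmetric)
qed

lemma comp_of_subgraph:
  assumes "wf_digraph T" "v \<in> verts T"
  shows "subgraph (comp_of T v) T"
proof -
  have "verts (comp_of T v) \<subseteq> verts T"
    using comp_of_verts[OF assms] by blast
  then show ?thesis
    using wf_digraph.subgraph_induce_subgraphI[OF assms(1)] by (simp add: comp_of_def)
qed

lemma comp_of_arc:
  assumes "b \<in> arcs T" "tail T b \<in> verts (comp_of T v) \<or> head T b \<in> verts (comp_of T v)"
  shows "b \<in> arcs (comp_of T v)" "tail T b \<in> verts (comp_of T v)" "head T b \<in> verts (comp_of T v)"
proof -
  have "(tail T b, head T b) \<in> parcs (mk_symmetric T)" "(head T b, tail T b) \<in> parcs (mk_symmetric T)"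
    using assms(1) by (auto simp: parcs_mk_symmetric)
  then show "tail T b \<in> verts (comp_of T v)" "head T b \<in> verts (comp_of T v)"
    using assms(2) by (auto simp: comp_of_def intro: rtrancl_into_rtrancl)
  then show "b \<in> arcs (comp_of T v)"
    using assms(1) by (simp add: comp_of_def)
qed

lemma comp_of_connected:
  assumes "wf_digraph T" "v \<in> verts T"
  shows "Digraph_Component.connected (comp_of T v)"
proof -
  let ?K = "comp_of T v"
  have K: "wf_digraph ?K"
    using comp_of_subgraph[OF assms] by blast
  have reach: "(v, u) \<in> (parcs (mk_symmetric ?K))\<^sup>*" if "(v, u) \<in> (parcs (mk_symmetric T))\<^sup>*" for u
    using that
  proof induction
    case (step x y)
    then obtain b where b: "b \<in> arcs T"
      and xy: "(x, y) = (tail T b, head T b) \<or> (x, y) = (head T b, tail T b)"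
      by (auto simp: parcs_mk_symmetric)
    have "x \<in> verts ?K"
      using step.hyps by (simp add: comp_of_def)
    with xy have "b \<in> arcs ?K"
      using comp_of_arc(1)[OF b] by auto
    with xy have "(x, y) \<in> parcs (mk_symmetric ?K)"
      by (auto simp: parcs_mk_symmetric comp_of_def)
    then show ?case
      using step.IH by simp
  qed simp
  have "(u, w) \<in> (parcs (mk_symmetric ?K))\<^sup>*" if "u \<in> verts ?K" "w \<in> verts ?K" for u w
  proof -
    have "(v, u) \<in> (parcs (mk_symmetric ?K))\<^sup>*" "(v, w) \<in> (parcs (mk_symmetric ?K))\<^sup>*"
      using that reach by (simp_all add: comp_of_def)
    then show ?thesis
      using sym_symmetric_arcs[of ?K] by (meson rtrancl_trans symD)
  qed
  moreover have "v \<in> verts ?K"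
    by (simp add: comp_of_def)
  ultimately show ?thesis
    unfolding connected_iff[OF K] by blast
qed

lemma connected_subgraph_comp_of:
  assumes sub: "subgraph K T" and K: "Digraph_Component.connected K" and v: "v \<in> verts K"
  shows "subgraph K (comp_of T v)"
proof -
  have wf: "wf_digraph K" "wf_digraph T" and vT: "v \<in> verts T"
    using sub v by (auto elim: subgraphE)
  have compat: "compatible T K"
    using sub by blast
  note comp = compatible_tail[OF compat] compatible_head[OF compat]
  have sym_sub: "parcs (mk_symmetric K) \<subseteq> parcs (mk_symmetric T)"
    using subgraph_mk_symmetric[OF sub] by (simp add: subgraph_def)
  have V: "verts K \<subseteq> verts (comp_of T v)"
  proof
    fix u assume "u \<in> verts K"
    then have "(v, u) \<in> (parcs (mk_symmetric K))\<^sup>*"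
      using K v unfolding connected_iff[OF wf(1)] by blast
    then show "u \<in> verts (comp_of T v)"
      using rtrancl_mono[OF sym_sub] by (auto simp: comp_of_def)
  qed
  moreover have "arcs K \<subseteq> arcs (comp_of T v)"
  proof
    fix b assume b: "b \<in> arcs K"
    then have "b \<in> arcs T"
      using sub by (auto elim: subgraphE)
    moreover have "tail T b \<in> verts (comp_of T v)"
      using wf_digraph.tail_in_verts[OF wf(1) b] V comp by auto
    ultimately show "b \<in> arcs (comp_of T v)"
      using comp_of_arc(1)[of b T v] by simp
  qed
  moreover have "compatible (comp_of T v) K"
    unfolding compatible_def comp_of_def induce_subgraph_tail induce_subgraph_head
    using comp by (intro conjI allI) simp_all
  ultimately show ?thesis
    using wf comp_of_subgraph[OF wf(2) vT, unfolded subgraph_def] by (intro subgraphI) simp_all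
qed

lemma subgraph_antisym:
  assumes "subgraph H K" "subgraph K H"
  shows "H = K"
proof -
  have compat: "compatible K H"
    using assms(1) by blast
  have "verts H = verts K" "arcs H = arcs K"
    using assms unfolding subgraph_def by blast+
  then show ?thesis
    using compatible_tail[OF compat] compatible_head[OF compat]
    by simp
qed

text \<open>
  Components are given as maximal connected subgraphs.  A connected subgraph containing \<open>v\<close> lies
  in \<^term>\<open>comp_of T v\<close>, which is itself connected, so this is the only maximal one through \<open>v\<close>.
\<close>

lemma components_eq:
  assumes "wf_digraph T"
  shows "components T = comp_of T ` verts T"
proof (intro equalityI subsetI)
  fix K assume "K \<in> components T"
  then have K: "subgraph K T" "Digraph_Component.connected K"
    and max: "\<And>H. H \<noteq> K \<Longrightarrow> subgraph K H \<Longrightarrow> subgraph H T \<Longrightarrow> \<not> Digraph_Component.connected H"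
    by (auto simp: components_def pre_digraph.max_subgraph_def)
  have "wf_digraph K"
    using K(1) by blast
  then obtain v where v: "v \<in> verts K"
    using K(2) by (auto simp: connected_iff)
  then have "v \<in> verts T"
    using subgraph_imp_subverts[OF K(1)] by blast
  then have "comp_of T v = K"
    using max[OF _ connected_subgraph_comp_of[OF K v]] comp_of_subgraph[OF assms]
      comp_of_connected[OF assms] by metis
  then show "K \<in> comp_of T ` verts T"
    using \<open>v \<in> verts T\<close> by blast
next
  fix K assume "K \<in> comp_of T ` verts T"
  then obtain v where v: "v \<in> verts T" and K: "K = comp_of T v"
    by blast
  have vK: "v \<in> verts K"
    by (simp add: K comp_of_def)
  have "H = K" if H: "subgraph K H" "subgraph H T" "Digraph_Component.connected H" for H
  proof -
    have "v \<in> verts H"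
      using vK subgraph_imp_subverts[OF H(1)] by blast
    from connected_subgraph_comp_of[OF H(2,3) this] have "subgraph H K"
      unfolding K .
    then show ?thesis
      using H(1) by (rule subgraph_antisym)
  qed
  then show "K \<in> components T"
    using comp_of_subgraph[OF assms v] comp_of_connected[OF assms v]
    unfolding components_def pre_digraph.max_subgraph_def K[symmetric] mem_Collect_eq by metis
qed

lemma comp_of_eq:
  assumes "u \<in> verts (comp_of T v)"
  shows "comp_of T u = comp_of T v"
proof -
  let ?S = "(parcs (mk_symmetric T))\<^sup>*"
  have "(v, u) \<in> ?S"
    using assms by (simp add: comp_of_def)
  moreover from this have "(u, v) \<in> ?S"
    using sym_symmetric_arcs[of T] by (meson symD)
  ultimately have "{x. (u, x) \<in> ?S} = {x. (v, x) \<in> ?S}"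
    by (auto intro: rtrancl_trans)
  then show ?thesis
    by (simp add: comp_of_def)
qed

section \<open>Circuits as cyclic sequences\<close>

lemma (in pre_digraph) cas_nth:
  assumes "cas u p v" "Suc i < length p"
  shows "head G (p ! i) = tail G (p ! Suc i)"
  using assms
proof (induction p arbitrary: u i)
  case (Cons e p)
  show ?case
  proof (cases i)
    case 0
    with Cons.prems show ?thesis
      by (cases p) auto
  next
    case (Suc j)
    with Cons.prems Cons.IH[of "head G e" j] show ?thesis
      by simp
  qed
qed simp

lemma (in pre_digraph) cas_head_last:
  assumes "cas u p v" "p \<noteq> []"
  shows "head G (last p) = v"
  using assms by (induction p arbitrary: u) (auto split: if_splits)

lemma (in pre_digraph) cas_snoc:
  assumes "cas u p (tail G e)" "head G e = v"
  shows "cas u (p @ [e]) v"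
  using assms by (induction p arbitrary: u) simp_all

text \<open>
  Presents a circuit by sequences indexed cyclically by all natural numbers, which spares the
  distinction of the last arc: its \<open>i\<close>-th arc \<open>b i\<close> leads from \<open>a i\<close> to \<open>a (Suc i)\<close>.
\<close>

lemma oriented_circuit_vertices:
  assumes wf: "wf_digraph K" and p: "oriented_circuit K p"
  obtains a b s where "0 < length p"
    and "\<And>i. a (i + length p) = a i"
    and "\<And>i j. a i = a j \<longleftrightarrow> i mod length p = j mod length p"
    and "\<And>i j. b i = b j \<longleftrightarrow> i mod length p = j mod length p"
    and "\<And>i. a i \<in> verts K" and "\<And>i. b i \<in> arcs K"
    and "\<And>i. s i \<Longrightarrow> tail K (b i) = a i \<and> head K (b i) = a (Suc i)"
    and "\<And>i. \<not> s i \<Longrightarrow> head K (b i) = a i \<and> tail K (b i) = a (Suc i)"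
    and "\<And>i. i < length p \<Longrightarrow> p ! i = (b i, s i)"
proof -
  let ?D = "oriented_double K" and ?k = "length p"
  interpret D: pre_digraph ?D .
  obtain u where u: "D.awalk u p u" "distinct (tl (D.awalk_verts u p))" "p \<noteq> []"
    and arcs: "distinct (map fst p)"
    using p by (auto simp: oriented_circuit_def D.cycle_def)
  have cas: "D.cas u p u" and set: "set p \<subseteq> arcs ?D" and "u \<in> verts K"
    using u(1)[unfolded D.awalk_def] by (simp_all add: oriented_double_def)
  have k: "0 < ?k"
    using u(3) by simp
  have heads: "distinct (map (head ?D) p)"
    using u(2,3) D.awalk_verts_conv'[OF cas] by simp
  define a where "a i = tail ?D (p ! (i mod ?k))" for i
  have arc: "fst (p ! (i mod ?k)) \<in> arcs K" for i
  proof -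
    have "p ! (i mod ?k) \<in> set p"
      using k by simp
    then show ?thesis
      using set by (auto simp: oriented_double_def)
  qed
  have a_Suc: "head ?D (p ! (i mod ?k)) = a (Suc i)" for i
  proof (cases "Suc (i mod ?k) = ?k")
    case True
    have "head ?D (last p) = u"
      using D.cas_head_last[OF cas u(3)] .
    moreover have "last p = p ! (i mod ?k)"
      using True u(3) by (metis diff_Suc_1 last_conv_nth)
    moreover have "a (Suc i) = u"
      using cas u(3) True unfolding a_def by (cases p) (auto simp: mod_Suc)
    ultimately show ?thesis
      by simp
  next
    case False
    moreover have "i mod ?k < ?k"
      using k by simp
    ultimately have "Suc (i mod ?k) < ?k"
      by linarith
    then show ?thesis
      using D.cas_nth[OF cas] False by (simp add: a_def mod_Suc)
  qed
  have a_per: "a (i + ?k) = a i" for i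
    by (simp add: a_def)
  have inj_Suc: "i mod ?k = j mod ?k" if "a (Suc i) = a (Suc j)" for i j
  proof -
    have "map (head ?D) p ! (i mod ?k) = map (head ?D) p ! (j mod ?k)"
      using that k by (simp add: a_Suc)
    then show ?thesis
      using heads k by (subst (asm) nth_eq_iff_index_eq) auto
  qed
  have inj: "a i = a j \<longleftrightarrow> i mod ?k = j mod ?k" for i j
  proof
    assume "a i = a j"
    then have "a (Suc (i + ?k - 1)) = a (Suc (j + ?k - 1))"
      using k a_per by simp
    then have "(i + ?k - 1) mod ?k = (j + ?k - 1) mod ?k"
      by (rule inj_Suc)
    then have "Suc (i + ?k - 1) mod ?k = Suc (j + ?k - 1) mod ?k"
      by (metis mod_Suc_eq)
    then show "i mod ?k = j mod ?k"
      using k by simp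
  qed (simp add: a_def)
  have ends: "if snd (p ! (i mod ?k))
      then tail K (fst (p ! (i mod ?k))) = a i \<and> head K (fst (p ! (i mod ?k))) = a (Suc i)
      else head K (fst (p ! (i mod ?k))) = a i \<and> tail K (fst (p ! (i mod ?k))) = a (Suc i)" for i
    using a_Suc[of i] a_def[of i] by (cases "p ! (i mod ?k)") (auto simp: oriented_double_def split: if_splits)
  have verts: "a i \<in> verts K" for i
    using ends[of i] wf_digraph.tail_in_verts[OF wf arc[of i]] wf_digraph.head_in_verts[OF wf arc[of i]]
    by (auto split: if_splits)
  have barc: "fst (p ! (i mod ?k)) = fst (p ! (j mod ?k)) \<longleftrightarrow> i mod ?k = j mod ?k" for i j
  proof -
    have "map fst p ! (i mod ?k) = map fst p ! (j mod ?k) \<longleftrightarrow> i mod ?k = j mod ?k"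
      using arcs k by (subst nth_eq_iff_index_eq) auto
    then show ?thesis
      using k by simp
  qed
  show thesis
  proof (rule that[of a "\<lambda>i. fst (p ! (i mod ?k))" "\<lambda>i. snd (p ! (i mod ?k))"])
    show "a i = a j \<longleftrightarrow> i mod ?k = j mod ?k" for i j
      by (rule inj)
  qed (use k a_per barc verts arc ends in simp_all)
qed

section \<open>The self-map of a matching of vertices with arcs\<close>

text \<open>
  Such a matching exists whenever the boundary matrix is invertible.  It orients every component
  towards its circuit: each vertex \<open>v\<close> is left along \<open>f v\<close>.
\<close>

locale vertex_arc_matching = fin_digraph T
  for T :: "('v, 'e) pre_digraph" +
  fixes f :: "'v \<Rightarrow> 'e"
  assumes f_bij: "bij_betw f (verts T) (arcs T)"
    and f_incident: "v \<in> verts T \<Longrightarrow> tail T (f v) = v \<or> head T (f v) = v"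

definition (in vertex_arc_matching) nxt :: "'v \<Rightarrow> 'v" where
  "nxt v = (if tail T (f v) = v then head T (f v) else tail T (f v))"

text \<open>
  Up to a factor of modulus 1, the column of \<open>f v\<close> in the matrix of the boundary map is the unit
  vector at \<open>v\<close> minus \<open>weight \<rho> v\<close> times the unit vector at \<open>nxt v\<close>.  So the weight is the inverse
  of the holonomy along the step from \<open>v\<close> to \<open>nxt v\<close>.
\<close>

definition (in vertex_arc_matching) weight :: "('e \<Rightarrow> complex) \<Rightarrow> 'v \<Rightarrow> complex" where
  "weight \<rho> v = (if tail T (f v) = v then inverse (\<rho> (f v)) else \<rho> (f v))"

lemma (in vertex_arc_matching) f_arc: "v \<in> verts T \<Longrightarrow> f v \<in> arcs T"
  using f_bij by (rule bij_betw_apply)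

lemma (in vertex_arc_matching) f_inj: "u \<in> verts T \<Longrightarrow> v \<in> verts T \<Longrightarrow> f u = f v \<longleftrightarrow> u = v"
  using bij_betw_imp_inj_on[OF f_bij] by (simp add: inj_on_eq_iff)

lemma (in vertex_arc_matching) f_surj:
  assumes "b \<in> arcs T"
  obtains v where "v \<in> verts T" "f v = b"
proof -
  have "b \<in> f ` verts T"
    using bij_betw_imp_surj_on[OF f_bij] assms by simp
  then show thesis
    using that by auto
qed

lemma (in vertex_arc_matching) f_ends:
  assumes "v \<in> verts T"
  shows "{tail T (f v), head T (f v)} = {v, nxt v}"
  using f_incident[OF assms] by (auto simp: nxt_def)

lemma (in vertex_arc_matching) nxt_in_verts:
  assumes "v \<in> verts T"
  shows "nxt v \<in> verts T"
  using f_arc[OF assms] by (simp add: nxt_def)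

lemma (in vertex_arc_matching) funpow_nxt_in_verts:
  assumes "v \<in> verts T"
  shows "(nxt ^^ n) v \<in> verts T"
  using assms by (induction n) (simp_all add: nxt_in_verts)

lemma (in vertex_arc_matching) nxt_in_comp:
  assumes "v \<in> verts T" "v \<in> verts (comp_of T x)"
  shows "f v \<in> arcs (comp_of T x)" "nxt v \<in> verts (comp_of T x)"
  using comp_of_arc[OF f_arc[OF assms(1)], of x] f_incident[OF assms(1)] assms(2)
  by (auto simp: nxt_def)

lemma (in vertex_arc_matching) funpow_nxt_in_comp:
  assumes "v \<in> verts T" "v \<in> verts (comp_of T x)"
  shows "(nxt ^^ n) v \<in> verts (comp_of T x)"
  using assms by (induction n) (simp_all add: nxt_in_comp funpow_nxt_in_verts)

text \<open>
  The vertices from which \<open>nxt\<close> leads to \<open>r\<close> are closed under \<open>nxt\<close>, as \<open>r\<close> itself returns to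
  \<open>r\<close>, and under taking preimages.  Every arc joins some \<open>z\<close> and \<open>nxt z\<close>, so they fill the
  whole component.
\<close>

lemma (in vertex_arc_matching) reaches_periodic:
  assumes k: "0 < k" "(nxt ^^ k) r = r" and r: "r \<in> verts T" and v: "v \<in> verts (comp_of T r)"
  shows "\<exists>n. (nxt ^^ n) v = r"
proof -
  have "(r, v) \<in> (parcs (mk_symmetric T))\<^sup>*"
    using v by (simp add: comp_of_def)
  then show ?thesis
  proof induction
    case base
    show ?case
      by (rule exI[of _ 0]) simp
  next
    case (step x y)
    from step.IH obtain n where n: "(nxt ^^ n) x = r" ..
    from step.hyps(2) obtain b where b: "b \<in> arcs T" "{x, y} = {tail T b, head T b}"
      by (auto simp: parcs_mk_symmetric)
    from b(1) obtain z where z: "z \<in> verts T" "f z = b"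
      by (rule f_surj)
    then have "{x, y} = {z, nxt z}"
      using f_ends[OF z(1)] b(2) by simp
    then consider "x = z" "y = nxt z" | "y = z" "x = nxt z"
      by (auto simp: doubleton_eq_iff)
    then show ?case
    proof cases
      case 1
      show ?thesis
      proof (cases n)
        case 0
        then have "(nxt ^^ (k - 1)) y = r"
          using k n 1 by (metis Suc_diff_1 comp_apply funpow_0 funpow_Suc_right)
        then show ?thesis ..
      next
        case (Suc m)
        then have "(nxt ^^ m) y = r"
          using n 1 by (simp add: funpow_swap1)
        then show ?thesis ..
      qed
    next
      case 2
      then have "(nxt ^^ Suc n) y = r"
        using n by (simp add: funpow_swap1)
      then show ?thesis ..
    qed
  qed
qed

lemma (in vertex_arc_matching) periodic_vertex:
  assumes v: "v \<in> verts T"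
  obtains m k where "0 < k" "(nxt ^^ k) ((nxt ^^ m) v) = (nxt ^^ m) v"
    "inj_on (\<lambda>i. (nxt ^^ i) ((nxt ^^ m) v)) {..<k}"
proof -
  have "range (\<lambda>n. (nxt ^^ n) v) \<subseteq> verts T"
    using funpow_nxt_in_verts[OF v] by blast
  then have "finite (range (\<lambda>n. (nxt ^^ n) v))"
    using finite_subset[OF _ finite_verts] by blast
  then have "\<not> inj (\<lambda>n. (nxt ^^ n) v)"
    using finite_imageD infinite_UNIV_nat by blast
  then obtain m n where mn: "m < n" "(nxt ^^ m) v = (nxt ^^ n) v"
    unfolding inj_def by (metis linorder_neqE_nat)
  let ?r = "(nxt ^^ m) v"
  define k where "k = (LEAST k. 0 < k \<and> (nxt ^^ k) ?r = ?r)"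
  have "0 < n - m \<and> (nxt ^^ (n - m)) ?r = ?r"
    using mn funpow_add[of "n - m" m nxt] by simp
  then have k: "0 < k \<and> (nxt ^^ k) ?r = ?r"
    unfolding k_def by (rule LeastI)
  have min: "(nxt ^^ i) ?r \<noteq> ?r" if "0 < i" "i < k" for i
    using not_less_Least[of i "\<lambda>k. 0 < k \<and> (nxt ^^ k) ?r = ?r"] that unfolding k_def by blast
  have ne: "(nxt ^^ i) ?r \<noteq> (nxt ^^ j) ?r" if "i < j" "j < k" for i j
  proof
    assume eq: "(nxt ^^ i) ?r = (nxt ^^ j) ?r"
    have "(nxt ^^ (k - j)) ((nxt ^^ i) ?r) = (nxt ^^ (k - j)) ((nxt ^^ j) ?r)"
      by (simp only: eq)
    then have "(nxt ^^ (k - j + i)) ?r = (nxt ^^ (k - j + j)) ?r"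
      by (simp only: funpow_add comp_apply)
    then have "(nxt ^^ (k - j + i)) ?r = ?r"
      using k that by simp
    moreover have "(nxt ^^ (k - j + i)) ?r \<noteq> ?r"
      by (rule min) (use that in simp_all)
    ultimately show False
      by (rule notE[rotated])
  qed
  have "inj_on (\<lambda>i. (nxt ^^ i) ?r) {..<k}"
    by (rule linorder_inj_onI) (use ne in auto)
  then show thesis
    using k that by blast
qed

text \<open>
  Needed so that the choice of a circuit in the definition of \<^const>\<open>rho_hat\<close> is not
  void: following \<open>nxt\<close> from \<open>v\<close> runs into a cycle, which traces out a circuit.
\<close>

lemma (in vertex_arc_matching) component_has_circuit:
  assumes v: "v \<in> verts T"
  shows "\<exists>p. oriented_circuit (comp_of T v) p"
proof -
  obtain m k where k: "0 < k" "(nxt ^^ k) ((nxt ^^ m) v) = (nxt ^^ m) v"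
    and inj: "inj_on (\<lambda>i. (nxt ^^ i) ((nxt ^^ m) v)) {..<k}"
    using periodic_vertex[OF v] .
  define r where "r = (nxt ^^ m) v"
  define e where "e i = (f ((nxt ^^ i) r), tail T (f ((nxt ^^ i) r)) = (nxt ^^ i) r)" for i
  define p where "p = map e [0..<k]"
  let ?K = "comp_of T v"
  let ?D = "oriented_double ?K"
  interpret D: pre_digraph ?D .
  have x: "(nxt ^^ i) r \<in> verts T" "(nxt ^^ i) r \<in> verts ?K" for i
  proof -
    have "v \<in> verts ?K"
      by (simp add: comp_of_def)
    then have "(nxt ^^ (i + m)) v \<in> verts ?K"
      by (rule funpow_nxt_in_comp[OF v])
    then show "(nxt ^^ i) r \<in> verts ?K"
      by (simp add: funpow_add r_def)
    show "(nxt ^^ i) r \<in> verts T"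
      unfolding r_def by (intro funpow_nxt_in_verts v)
  qed
  have ends: "tail ?D (e i) = (nxt ^^ i) r" "head ?D (e i) = (nxt ^^ Suc i) r" for i
    using f_incident[OF x(1)[of i]] by (auto simp: e_def oriented_double_def comp_of_def nxt_def)
  have cas: "D.cas r (map e [0..<j]) ((nxt ^^ j) r)" for j
  proof (induction j)
    case (Suc j)
    have "D.cas r (map e [0..<j] @ [e j]) ((nxt ^^ Suc j) r)"
      using Suc.IH ends[of j] by (intro D.cas_snoc) simp_all
    then show ?case
      by simp
  qed simp
  have "set p \<subseteq> arcs ?D"
    using nxt_in_comp(1)[OF x] by (auto simp: p_def e_def oriented_double_def)
  moreover have "r \<in> verts ?D"
    using x(2)[of 0] by (simp add: oriented_double_def)
  moreover have cas_p: "D.cas r p r"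
    using cas[of k] k(2) by (simp add: p_def r_def)
  ultimately have walk: "D.awalk r p r"
    by (simp add: D.awalk_def)
  have ne: "p \<noteq> []"
    using k(1) by (simp add: p_def)
  have inj_r: "inj_on (\<lambda>i. (nxt ^^ i) r) {0..<k}"
    using inj by (simp add: r_def atLeast0LessThan)
  have "distinct (map fst p)"
    using inj_r x(1) f_inj by (auto simp: p_def e_def distinct_map inj_on_def)
  moreover have "distinct (map (head ?D) p)"
  proof -
    have "map (head ?D) p = map (\<lambda>i. (nxt ^^ i) r) (map Suc [0..<k])"
      using ends by (simp add: p_def)
    also have "\<dots> = map (\<lambda>i. (nxt ^^ i) r) ([1..<k] @ [k])"
      using k(1) by (simp add: map_Suc_upt del: upt_Suc) (simp add: upt_Suc)
    finally have "map (head ?D) p = map (\<lambda>i. (nxt ^^ i) r) [1..<k] @ [r]"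
      using k(2) by (simp add: r_def)
    moreover have "distinct (map (\<lambda>i. (nxt ^^ i) r) [0..<k])"
      using inj_r by (simp add: distinct_map)
    then have "distinct (map (\<lambda>i. (nxt ^^ i) r) (0 # [1..<k]))"
      using upt_conv_Cons[OF k(1)] by simp
    ultimately show ?thesis
      by auto
  qed
  ultimately have "oriented_circuit ?K p"
    using walk ne D.awalk_verts_conv'[OF cas_p]
    unfolding oriented_circuit_def D.cycle_def by auto
  then show ?thesis ..
qed

text \<open>
  The matching assigns each arc \<open>b i\<close> of the circuit to one of its endpoints \<open>a i\<close> and \<open>a (Suc i)\<close>.
  If \<open>b (Suc i)\<close> is assigned to \<open>a (Suc i)\<close>, then \<open>b i\<close> can only be assigned to \<open>a i\<close>; going round the
  circuit, either all arcs are assigned to their start or all to their end.  In the first case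
  \<open>nxt\<close> follows the circuit, in the second it runs backwards.  A single loop has to be
  treated apart, since there the two endpoints coincide.
\<close>

lemma (in vertex_arc_matching) circuit_is_orbit:
  assumes sub: "subgraph K T" and p: "oriented_circuit K p"
  obtains r k where "r \<in> verts K" "0 < k" "(nxt ^^ k) r = r"
    "\<And>i. 0 < i \<Longrightarrow> i < k \<Longrightarrow> (nxt ^^ i) r \<noteq> r"
    "(\<Prod>i<k. weight \<rho> ((nxt ^^ i) r)) \<in> {holonomy \<rho> p, inverse (holonomy \<rho> p)}"
proof -
  let ?k = "length p"
  have compat: "compatible T K" and wfK: "wf_digraph K"
    and sub_sets: "verts K \<subseteq> verts T" "arcs K \<subseteq> arcs T"
    using sub by (simp_all add: subgraph_def)
  obtain a b s where k: "0 < ?k" and a_per: "\<And>i. a (i + ?k) = a i"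
    and a_eq: "\<And>i j. a i = a j \<longleftrightarrow> i mod ?k = j mod ?k"
    and b_eq: "\<And>i j. b i = b j \<longleftrightarrow> i mod ?k = j mod ?k"
    and a_K: "\<And>i. a i \<in> verts K" and b_K: "\<And>i. b i \<in> arcs K"
    and ends_True: "\<And>i. s i \<Longrightarrow> tail K (b i) = a i \<and> head K (b i) = a (Suc i)"
    and ends_False: "\<And>i. \<not> s i \<Longrightarrow> head K (b i) = a i \<and> tail K (b i) = a (Suc i)"
    and p_nth: "\<And>i. i < ?k \<Longrightarrow> p ! i = (b i, s i)"
    by (rule oriented_circuit_vertices[OF wfK p]) (rule that, assumption+)
  have ends: "s i \<Longrightarrow> tail T (b i) = a i" "s i \<Longrightarrow> head T (b i) = a (Suc i)"
    "\<not> s i \<Longrightarrow> head T (b i) = a i" "\<not> s i \<Longrightarrow> tail T (b i) = a (Suc i)" for i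
    using ends_True[of i] ends_False[of i] compatible_tail[OF compat] compatible_head[OF compat]
    by simp_all
  have a_T: "a i \<in> verts T" and b_T: "b i \<in> arcs T" for i
    using a_K[of i] b_K[of i] sub_sets by blast+
  \<comment> \<open>contribution of the \<open>i\<close>-th arc to the holonomy\<close>
  define hol where "hol i = \<rho> (b i) powi (if s i then 1 else -1)" for i
  have "holonomy \<rho> p = (\<Prod>i=0..<?k. hol i)"
    unfolding holonomy_def prod.list_conv_set_nth
    by (intro prod.cong) (simp_all add: hol_def p_nth)
  then have holonomy: "holonomy \<rho> p = (\<Prod>i<?k. hol i)"
    by (simp add: atLeast0LessThan)
  \<comment> \<open>the vertex to which the \<open>i\<close>-th arc is assigned\<close>
  define m where "m i = inv_into (verts T) f (b i)" for i
  have m: "m i \<in> verts T" "f (m i) = b i" for i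
    using b_T[of i] bij_betw_imp_surj_on[OF f_bij]
    by (simp_all add: m_def inv_into_into f_inv_into_f)
  have m_cases: "m i = a i \<or> m i = a (Suc i)" for i
    using f_incident[OF m(1)[of i]] ends[of i] by (cases "s i") (auto simp: m(2))
  have m_per: "m i = m j" if "i mod ?k = j mod ?k" for i j
    using that b_eq[of i j] by (simp add: m_def)
  show thesis
  proof (cases "?k = 1")
    case True
    then have a1: "a (Suc 0) = a 0"
      by (simp add: a_eq)
    then have f0: "f (a 0) = b 0"
      using m_cases[of 0] m(2)[of 0] by auto
    have loop: "tail T (b 0) = a 0" "head T (b 0) = a 0"
      using ends[of 0] a1 by (cases "s 0"; simp)+
    have "nxt (a 0) = a 0"
      by (simp add: nxt_def f0 loop)
    moreover have "weight \<rho> (a 0) \<in> {holonomy \<rho> p, inverse (holonomy \<rho> p)}"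
      using True by (simp add: holonomy weight_def f0 loop hol_def)
    ultimately show thesis
      using a_K[of 0] by (intro that[of "a 0" 1]) auto
  next
    case False
    with k have k2: "1 < ?k"
      by arith
    have mod_Suc_neq: "i mod ?k \<noteq> Suc i mod ?k" for i
      using k2 by (simp add: mod_Suc)
    then have a_neq: "a i \<noteq> a (Suc i)" for i
      by (simp add: a_eq)
    have backward: "m i = a i" if "m (Suc i) = a (Suc i)" for i
    proof (rule ccontr)
      assume "m i \<noteq> a i"
      then have "m i = m (Suc i)"
        using m_cases[of i] that by simp
      then have "b i = b (Suc i)"
        using m(2)[of i] m(2)[of "Suc i"] by simp
      then show False
        using mod_Suc_neq by (simp add: b_eq)
    qed
    have backward_le: "m j = a j" if "m (j + n) = a (j + n)" for j n
      using that by (induction n) (auto intro: backward)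
    consider "\<And>i. m i = a i" | "\<And>i. m i = a (Suc i)"
    proof (cases "\<exists>i. m i = a i")
      case True
      then obtain i where i: "m i = a i" ..
      have "m j = a j" for j
      proof -
        have "(i + ?k) mod ?k = i mod ?k"
          by simp
        then have *: "m (i + ?k) = a (i + ?k)"
          using m_per[of "i + ?k" i] a_per[of i] i by simp
        have "j mod ?k < ?k"
          using k by simp
        then have "j mod ?k + (i + ?k - j mod ?k) = i + ?k"
          by simp
        then have "m (j mod ?k) = a (j mod ?k)"
          using backward_le[of "j mod ?k" "i + ?k - j mod ?k"] * by simp
        moreover have "m (j mod ?k) = m j" "a (j mod ?k) = a j"
          using m_per[of "j mod ?k" j] a_eq[of "j mod ?k" j] by simp_all
        ultimately show ?thesis
          by simp
      qed
      then show thesis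
        using that(1) by blast
    next
      case False
      then show thesis
        using m_cases that(2) by blast
    qed
    then show thesis
    proof cases
      case 1
      have f_a: "f (a i) = b i" for i
        using m(2)[of i] 1 by simp
      have step: "nxt (a i) = a (Suc i)" for i
        using ends[of i] a_neq[of i] by (cases "s i") (auto simp: nxt_def f_a)
      have wt: "weight \<rho> (a i) = inverse (hol i)" for i
        using ends[of i] a_neq[of i] by (cases "s i") (auto simp: weight_def f_a hol_def)
      have pow: "(nxt ^^ i) (a 0) = a i" for i
        by (induction i) (simp_all add: step)
      show thesis
      proof (rule that[of "a 0" ?k])
        show "(nxt ^^ ?k) (a 0) = a 0"
          unfolding pow using a_per[of 0] by simp
        show "(nxt ^^ i) (a 0) \<noteq> a 0" if "0 < i" "i < ?k" for i
          unfolding pow using that by (simp add: a_eq)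
        have "(\<Prod>i<?k. weight \<rho> ((nxt ^^ i) (a 0))) = inverse (holonomy \<rho> p)"
          unfolding pow holonomy by (simp add: wt prod_inversef[unfolded comp_def])
        then show "(\<Prod>i<?k. weight \<rho> ((nxt ^^ i) (a 0))) \<in> {holonomy \<rho> p, inverse (holonomy \<rho> p)}"
          by simp
      qed (use a_K k in auto)
    next
      case 2
      have f_a: "f (a (Suc i)) = b i" for i
        using m(2)[of i] 2 by simp
      have step: "nxt (a (Suc i)) = a i" for i
        using ends[of i] a_neq[of i] by (cases "s i") (auto simp: nxt_def f_a)
      have wt: "weight \<rho> (a (Suc i)) = hol i" for i
        using ends[of i] a_neq[of i] by (cases "s i") (auto simp: weight_def f_a hol_def)
      have pow: "(nxt ^^ i) (a (i + j)) = a j" for i j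
      proof (induction i arbitrary: j)
        case (Suc i)
        have "(nxt ^^ i) (a (Suc i + j)) = a (Suc j)"
          using Suc.IH[of "Suc j"] by simp
        then show ?case
          by (simp add: step)
      qed simp
      have pow': "(nxt ^^ i) (a ?k) = a (?k - i)" if "i \<le> ?k" for i
        using pow[of i "?k - i"] that by simp
      show thesis
      proof (rule that[of "a ?k" ?k])
        show "(nxt ^^ ?k) (a ?k) = a ?k"
          using pow'[of ?k] a_per[of 0] by simp
        show "(nxt ^^ i) (a ?k) \<noteq> a ?k" if "0 < i" "i < ?k" for i
          using that pow'[of i] by (simp add: a_eq)
        have "(\<Prod>i<?k. weight \<rho> ((nxt ^^ i) (a ?k))) = (\<Prod>i<?k. hol (?k - Suc i))"
        proof (intro prod.cong refl)
          fix i assume "i \<in> {..<?k}"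
          then have "?k - i = Suc (?k - Suc i)" "i \<le> ?k"
            by auto
          then show "weight \<rho> ((nxt ^^ i) (a ?k)) = hol (?k - Suc i)"
            using pow'[of i] wt[of "?k - Suc i"] by simp
        qed
        also have "\<dots> = holonomy \<rho> p"
          unfolding holonomy by (rule prod.nat_diff_reindex)
        finally show "(\<Prod>i<?k. weight \<rho> ((nxt ^^ i) (a ?k))) \<in> {holonomy \<rho> p, inverse (holonomy \<rho> p)}"
          by simp
      qed (use a_K k in auto)
    qed
  qed
qed

section \<open>The squared modulus of the determinant of a spanning tree\<close>

definition incidence :: "('v, 'e) pre_digraph \<Rightarrow> ('e \<Rightarrow> complex) \<Rightarrow> 'v \<Rightarrow> 'e \<Rightarrow> complex" where
  "incidence G \<rho> v b = \<rho> b * basis_chain (tail G b) v - basis_chain (head G b) v"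

lemma cmod_holonomy:
  assumes "\<And>b. b \<in> fst ` set p \<Longrightarrow> cmod (\<rho> b) = 1"
  shows "cmod (holonomy \<rho> p) = 1"
  using assms
proof (induction p)
  case (Cons x p)
  have "holonomy \<rho> (x # p) = \<rho> (fst x) powi (if snd x then 1 else -1) * holonomy \<rho> p"
    by (cases x) (simp add: holonomy_def)
  then show ?case
    using Cons by (simp add: norm_mult norm_power_int)
qed (simp add: holonomy_def)

text \<open>
  After reordering the columns by \<open>f\<close> and scaling them by \<open>c\<close>, the matrix has the
  form treated in \<open>minor_functional\<close>.  As root of a component \<open>K\<close> serves a vertex \<open>r K\<close> on the
  circuit that \<^const>\<open>rho_hat\<close> selects in \<open>K\<close>, so that the factor of this root is directly
  comparable with the holonomy of that circuit.
\<close>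

lemma (in vertex_arc_matching) minor_incidence:
  assumes \<rho>: "\<And>b. b \<in> arcs T \<Longrightarrow> cmod (\<rho> b) = 1"
  shows "minor (incidence T \<rho>) (verts T) (arcs T) * cnj (minor (incidence T \<rho>) (verts T) (arcs T))
    = rho_hat \<rho> T"
proof -
  let ?V = "verts T"
  have \<rho>_0: "\<rho> b \<noteq> 0" if "b \<in> arcs T" for b
    using \<rho>[OF that] by auto
  define p where "p K = (SOME p. oriented_circuit K p)" for K :: "('v, 'e) pre_digraph"
  \<comment> \<open>\<open>r\<close> lies on the selected circuit of \<open>K\<close>, a \<open>nxt\<close>-cycle of length \<open>k\<close>\<close>
  define good where "good K r k \<longleftrightarrow> r \<in> verts K \<and> 0 < k \<and> (nxt ^^ k) r = r \<and>
      (\<forall>i. 0 < i \<longrightarrow> i < k \<longrightarrow> (nxt ^^ i) r \<noteq> r) \<and>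
      (\<Prod>i<k. weight \<rho> ((nxt ^^ i) r)) \<in> {holonomy \<rho> (p K), inverse (holonomy \<rho> (p K))} \<and>
      cmod (holonomy \<rho> (p K)) = 1" for K r k
  have ex: "\<exists>r k. good K r k"
    if K: "K \<in> components T" for K
  proof -
    obtain v where v: "v \<in> ?V" "K = comp_of T v"
      using K components_eq[OF wf_digraph_axioms] by auto
    have sub: "subgraph K T"
      using comp_of_subgraph[OF wf_digraph_axioms v(1)] v(2) by simp
    have "\<exists>p. oriented_circuit K p"
      using component_has_circuit[OF v(1)] v(2) by simp
    then have circ: "oriented_circuit K (p K)"
      unfolding p_def by (rule someI_ex)
    then have "set (p K) \<subseteq> arcs (oriented_double K)"
      by (auto simp: oriented_circuit_def pre_digraph.cycle_def pre_digraph.awalk_def)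
    then have "fst ` set (p K) \<subseteq> arcs K"
      by (auto simp: oriented_double_def)
    then have "cmod (\<rho> b) = 1" if "b \<in> fst ` set (p K)" for b
      using \<rho> sub that by (auto simp: subgraph_def)
    then have "cmod (holonomy \<rho> (p K)) = 1"
      by (rule cmod_holonomy)
    moreover obtain r k where "r \<in> verts K" "0 < k" "(nxt ^^ k) r = r"
      "\<And>i. 0 < i \<Longrightarrow> i < k \<Longrightarrow> (nxt ^^ i) r \<noteq> r"
      "(\<Prod>i<k. weight \<rho> ((nxt ^^ i) r)) \<in> {holonomy \<rho> (p K), inverse (holonomy \<rho> (p K))}"
      by (rule circuit_is_orbit[where \<rho> = \<rho>, OF sub circ]) (rule that, assumption+)
    ultimately show ?thesis
      unfolding good_def by blast
  qed
  obtain r per where good: "\<And>K. K \<in> components T \<Longrightarrow> good K (r K) (per K)"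
    using ex by metis
  define k where "k v = per (comp_of T v)" for v
  define R where "R = r ` components T"
  define \<omega> where "\<omega> v = (\<Prod>i<k v. weight \<rho> ((nxt ^^ i) v))" for v
  have r_V: "r K \<in> ?V" and comp_r: "comp_of T (r K) = K" if K: "K \<in> components T" for K
  proof -
    obtain v where v: "v \<in> ?V" "K = comp_of T v"
      using K components_eq[OF wf_digraph_axioms] by auto
    have rK: "r K \<in> verts (comp_of T v)"
      using good[OF K] unfolding good_def v(2) by blast
    show "r K \<in> ?V"
      by (rule comp_of_verts[OF wf_digraph_axioms v(1) rK])
    show "comp_of T (r K) = K"
      using comp_of_eq[OF rK] v(2) by simp
  qed
  have r_inj: "inj_on r (components T)"
    by (rule inj_on_inverseI[where g = "comp_of T"]) (rule comp_r)
  have R: "0 < k x" "(nxt ^^ k x) x = x" "0 < i \<Longrightarrow> i < k x \<Longrightarrow> (nxt ^^ i) x \<noteq> x" "x \<in> ?V"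
    "r (comp_of T x) = x" "comp_of T x \<in> components T"
    if x: "x \<in> R" for x i
  proof -
    obtain K where K: "K \<in> components T" "x = r K"
      using x by (auto simp: R_def)
    then show "0 < k x" "(nxt ^^ k x) x = x" "0 < i \<Longrightarrow> i < k x \<Longrightarrow> (nxt ^^ i) x \<noteq> x"
      "x \<in> ?V" "r (comp_of T x) = x" "comp_of T x \<in> components T"
      using good[OF K(1)] r_V[OF K(1)] comp_r[OF K(1)] K by (simp_all add: k_def good_def)
  qed
  define M where
    "M u v = (if u = v then 1 else 0) - (if u = nxt v then weight \<rho> v else 0)" for u v
  \<comment> \<open>the factor of modulus 1 split off from column \<open>f v\<close>\<close>
  define c where "c v = (if tail T (f v) = v then \<rho> (f v) else -1)" for v
  have c: "cmod (c v) = 1" if "v \<in> ?V" for v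
    using \<rho>[OF f_arc[OF that]] by (simp add: c_def)
  have M: "minor M ?V ?V = (\<Prod>x\<in>R. 1 - \<omega> x)"
    unfolding M_def \<omega>_def
  proof (rule minor_functional[OF finite_verts])
    show "R \<subseteq> ?V"
      using R(4) by blast
    show "nxt v \<in> ?V" if "v \<in> ?V" for v
      using that by (rule nxt_in_verts)
    show "0 < k x" if "x \<in> R" for x
      using that by (rule R(1))
    show "(nxt ^^ k x) x = x" if "x \<in> R" for x
      using that by (rule R(2))
    show "\<exists>n. (nxt ^^ n) v \<in> R" if v: "v \<in> ?V" for v
    proof -
      let ?K = "comp_of T v"
      have K: "?K \<in> components T"
        using components_eq[OF wf_digraph_axioms] v by blast
      then have "r ?K \<in> R"
        by (simp add: R_def)
      moreover have "\<exists>n. (nxt ^^ n) v = r ?K"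
      proof (rule reaches_periodic)
        show "0 < k (r ?K)" "(nxt ^^ k (r ?K)) (r ?K) = r ?K"
          using R(1,2)[OF \<open>r ?K \<in> R\<close>] .
        show "r ?K \<in> ?V" using r_V[OF K] .
        show "v \<in> verts (comp_of T (r ?K))"
          unfolding comp_r[OF K] by (simp add: comp_of_def)
      qed
      ultimately show ?thesis
        by metis
    qed
    show "(nxt ^^ i) x \<notin> R" if x: "x \<in> R" "0 < i" "i < k x" for x i
    proof
      assume y: "(nxt ^^ i) x \<in> R"
      have "(nxt ^^ i) x \<in> verts (comp_of T x)"
        using R(4)[OF x(1)] by (intro funpow_nxt_in_comp) (simp_all add: comp_of_def)
      then have "comp_of T ((nxt ^^ i) x) = comp_of T x"
        by (rule comp_of_eq)
      then have "(nxt ^^ i) x = x"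
        using R(5)[OF x(1)] R(5)[OF y] by simp
      then show False
        using R(3)[OF x] by simp
    qed
  qed
  have "minor (\<lambda>u v. incidence T \<rho> u (f v)) ?V ?V
      = minor (\<lambda>u v. \<Sum>x\<in>?V. M u x * (if x = v then c v else 0)) ?V ?V"
  proof (intro minor_cong refl finite_verts)
    fix u v assume uv: "u \<in> ?V" "v \<in> ?V"
    have "(\<Sum>x\<in>?V. M u x * (if x = v then c v else 0)) = (\<Sum>x\<in>?V. if x = v then M u x * c v else 0)"
      by (intro sum.cong) auto
    also have "\<dots> = M u v * c v"
      using uv by simp
    also have "\<dots> = incidence T \<rho> u (f v)"
      using f_incident[OF uv(2)] \<rho>_0[OF f_arc[OF uv(2)]]
      by (cases "tail T (f v) = v")
         (simp_all add: incidence_def basis_chain_def M_def c_def weight_def nxt_def field_simps)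
    finally show "incidence T \<rho> u (f v) = (\<Sum>x\<in>?V. M u x * (if x = v then c v else 0))" ..
  qed
  also have "\<dots> = minor M ?V ?V * minor (\<lambda>x v. if x = v then c v else 0) ?V ?V"
    by (intro minor_mult) auto
  also have "minor (\<lambda>x v. if x = v then c v else 0) ?V ?V = (\<Prod>v\<in>?V. c v)"
    using minor_triangular[OF finite_verts, of "\<lambda>x v. if x = v then c v else 0" "\<lambda>_. 0"] by simp
  finally have inc: "minor (\<lambda>u v. incidence T \<rho> u (f v)) ?V ?V = (\<Prod>x\<in>R. 1 - \<omega> x) * (\<Prod>v\<in>?V. c v)"
    unfolding M .
  obtain s :: complex where s: "s * s = 1"
    and "minor (\<lambda>u v. incidence T \<rho> u (f v)) ?V ?V = minor (incidence T \<rho>) ?V (arcs T) * s"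
    using minor_reindex_columns[where A = "incidence T \<rho>", OF finite_verts finite_arcs f_bij] .
  then have "minor (incidence T \<rho>) ?V (arcs T) * (s * s) = (\<Prod>x\<in>R. 1 - \<omega> x) * (\<Prod>v\<in>?V. c v) * s"
    using inc by simp
  then have minor: "minor (incidence T \<rho>) ?V (arcs T) = (\<Prod>x\<in>R. 1 - \<omega> x) * (\<Prod>v\<in>?V. c v) * s"
    by (simp add: s)
  have "s = 1 \<or> s = -1"
    using s by (simp only: square_eq_1_iff)
  then have "cmod s = 1"
    by (elim disjE) simp_all
  moreover have "cmod (\<Prod>v\<in>?V. c v) = 1"
    using c by (simp add: prod_norm[symmetric])
  ultimately have "minor (incidence T \<rho>) ?V (arcs T) * cnj (minor (incidence T \<rho>) ?V (arcs T))
      = (\<Prod>x\<in>R. 1 - \<omega> x) * cnj (\<Prod>x\<in>R. 1 - \<omega> x)"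
    unfolding complex_norm_square[symmetric] minor by (simp add: norm_mult)
  also have "\<dots> = (\<Prod>x\<in>R. (1 - \<omega> x) * cnj (1 - \<omega> x))"
    by (simp add: prod.distrib)
  also have "\<dots> = (\<Prod>K\<in>components T. (1 - \<omega> (r K)) * cnj (1 - \<omega> (r K)))"
    unfolding R_def by (rule prod.reindex_cong[OF r_inj refl refl])
  also have "\<dots> = rho_hat \<rho> T"
    unfolding rho_hat_def Let_def p_def[symmetric]
  proof (intro prod.cong refl)
    fix K assume K: "K \<in> components T"
    let ?h = "holonomy \<rho> (p K)"
    have h: "?h * cnj ?h = 1"
      using good[OF K] unfolding complex_norm_square[symmetric] good_def by simp
    then have inv: "inverse ?h = cnj ?h"
      by (rule inverse_unique)
    have "\<omega> (r K) = ?h \<or> \<omega> (r K) = cnj ?h"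
      using good[OF K] unfolding inv \<omega>_def k_def comp_r[OF K] good_def by simp
    then show "(1 - \<omega> (r K)) * cnj (1 - \<omega> (r K)) = (?h - 1) * (cnj ?h - 1)"
      by (elim disjE) (simp_all add: algebra_simps)
  qed
  finally show ?thesis .
qed

section \<open>Minors and bijectivity\<close>

lemma minor_inverse:
  fixes A :: "'v \<Rightarrow> 'e \<Rightarrow> complex"
  assumes V: "finite V" and E: "finite E" and card: "card E = card V" and nz: "minor A V E \<noteq> 0"
  obtains X where
    "\<And>u v. u \<in> V \<Longrightarrow> v \<in> V \<Longrightarrow> (\<Sum>b\<in>E. A u b * X b v) = (if u = v then 1 else 0)"
    "\<And>b c. b \<in> E \<Longrightarrow> c \<in> E \<Longrightarrow> (\<Sum>v\<in>V. X b v * A v c) = (if b = c then 1 else 0)"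
proof -
  let ?n = "card V" and ?v = "from_nat_into V" and ?e = "from_nat_into E"
  let ?I = "{0..<card V}"
  define M where "M = mat ?n ?n (\<lambda>(i, j). A (?v i) (?e j))"
  have M: "M \<in> carrier_mat ?n ?n"
    by (simp add: M_def)
  have det: "det M \<noteq> 0"
    using nz by (simp add: minor_def M_def)
  let ?N = "adj_mat M"
  have N: "?N \<in> carrier_mat ?n ?n" "M * ?N = det M \<cdot>\<^sub>m 1\<^sub>m ?n" "?N * M = det M \<cdot>\<^sub>m 1\<^sub>m ?n"
    using adj_mat[OF M] by simp_all
  have v: "bij_betw ?v ?I V"
    using from_nat_into_bij[OF V] .
  have e: "bij_betw ?e ?I E"
    using from_nat_into_bij[OF E] by (simp add: card)
  define X where "X b w = ?N $$ (inv_into ?I ?e b, inv_into ?I ?v w) / det M" for b w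
  have X: "X (?e i) (?v j) = ?N $$ (i, j) / det M" if "i \<in> ?I" "j \<in> ?I" for i j
    using that by (simp add: X_def bij_betw_inv_into_left[OF e] bij_betw_inv_into_left[OF v])
  have obt_v: "\<exists>i\<in>?I. u = ?v i" if "u \<in> V" for u
    using bij_betw_imp_surj_on[OF v] that by force
  have obt_e: "\<exists>i\<in>?I. b = ?e i" if "b \<in> E" for b
    using bij_betw_imp_surj_on[OF e] that by force
  show thesis
  proof
    fix u w assume "u \<in> V" "w \<in> V"
    then obtain i j where ij: "i \<in> ?I" "j \<in> ?I" "u = ?v i" "w = ?v j"
      using obt_v by metis
    have "(\<Sum>b\<in>E. A u b * X b w) = (\<Sum>l\<in>?I. A u (?e l) * X (?e l) w)"
      by (rule sum.reindex_bij_betw[OF e, symmetric])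
    also have "\<dots> = (\<Sum>l\<in>?I. M $$ (i, l) * ?N $$ (l, j)) / det M"
      unfolding sum_divide_distrib using ij by (intro sum.cong) (simp_all add: X M_def)
    also have "(\<Sum>l\<in>?I. M $$ (i, l) * ?N $$ (l, j)) = (M * ?N) $$ (i, j)"
      using ij M N(1) by (simp add: scalar_prod_def)
    also have "\<dots> / det M = (if i = j then 1 else 0)"
      unfolding N(2) using ij det by simp
    also have "\<dots> = (if u = w then 1 else 0)"
      using ij from_nat_into_eq_iff[OF V, of i j] by simp
    finally show "(\<Sum>b\<in>E. A u b * X b w) = (if u = w then 1 else 0)" .
  next
    fix b c assume "b \<in> E" "c \<in> E"
    then obtain i j where ij: "i \<in> ?I" "j \<in> ?I" "b = ?e i" "c = ?e j"
      using obt_e by metis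
    have "(\<Sum>w\<in>V. X b w * A w c) = (\<Sum>l\<in>?I. X b (?v l) * A (?v l) c)"
      by (rule sum.reindex_bij_betw[OF v, symmetric])
    also have "\<dots> = (\<Sum>l\<in>?I. ?N $$ (i, l) * M $$ (l, j)) / det M"
      unfolding sum_divide_distrib using ij by (intro sum.cong) (simp_all add: X M_def)
    also have "(\<Sum>l\<in>?I. ?N $$ (i, l) * M $$ (l, j)) = (?N * M) $$ (i, j)"
      using ij M N(1) by (simp add: scalar_prod_def)
    also have "\<dots> / det M = (if i = j then 1 else 0)"
      unfolding N(3) using ij det by simp
    also have "\<dots> = (if b = c then 1 else 0)"
      using ij from_nat_into_eq_iff[OF E, of i j] card by simp
    finally show "(\<Sum>w\<in>V. X b w * A w c) = (if b = c then 1 else 0)" .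
  qed
qed

text \<open>
  From right to left, surjectivity provides a right inverse \<open>X\<close> of \<open>A\<close>, and injectivity
  makes it a left inverse as well.  The traces of \<open>A X\<close> and \<open>X A\<close> agree, and they are the numbers of
  rows and columns.
\<close>

lemma minor_neq_0_iff_bijective:
  fixes A :: "'v \<Rightarrow> 'e \<Rightarrow> complex"
  assumes V: "finite V" and E: "finite E"
  shows "card E = card V \<and> minor A V E \<noteq> 0 \<longleftrightarrow>
    (\<forall>x\<in>chains E. (\<forall>v\<in>V. (\<Sum>b\<in>E. x b * A v b) = 0) \<longrightarrow> x = (\<lambda>_. 0)) \<and>
    (\<forall>y\<in>chains V. \<exists>x\<in>chains E. \<forall>v\<in>V. (\<Sum>b\<in>E. x b * A v b) = y v)"
    (is "?L \<longleftrightarrow> ?inj \<and> ?surj")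
proof
  assume ?L
  then have L: "card E = card V" "minor A V E \<noteq> 0"
    by simp_all
  obtain X where
    X1: "\<And>u v. u \<in> V \<Longrightarrow> v \<in> V \<Longrightarrow> (\<Sum>b\<in>E. A u b * X b v) = (if u = v then 1 else 0)" and
    X2: "\<And>b c. b \<in> E \<Longrightarrow> c \<in> E \<Longrightarrow> (\<Sum>v\<in>V. X b v * A v c) = (if b = c then 1 else 0)"
    by (rule minor_inverse[OF V E L]) (rule that, assumption+)
  have ?inj
  proof (intro ballI impI ext)
    fix x b assume x: "x \<in> chains E" and ker: "\<forall>v\<in>V. (\<Sum>c\<in>E. x c * A v c) = 0"
    show "x b = 0"
    proof (cases "b \<in> E")
      case True
      have "x b = (\<Sum>c\<in>E. if b = c then x c else 0)"
        using True E by simp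
      also have "\<dots> = (\<Sum>c\<in>E. \<Sum>v\<in>V. X b v * A v c * x c)"
        by (intro sum.cong refl) (simp add: sum_distrib_right[symmetric] X2[OF True])
      also have "\<dots> = (\<Sum>v\<in>V. X b v * (\<Sum>c\<in>E. x c * A v c))"
        by (subst sum.swap) (simp add: sum_distrib_left mult_ac)
      also have "\<dots> = 0"
        using ker by simp
      finally show ?thesis .
    qed (use x in \<open>simp add: chains_def\<close>)
  qed
  moreover have ?surj
  proof
    fix y :: "'v \<Rightarrow> complex" assume y: "y \<in> chains V"
    define x where "x b = (if b \<in> E then \<Sum>v\<in>V. X b v * y v else 0)" for b
    have "(\<Sum>b\<in>E. x b * A u b) = y u" if u: "u \<in> V" for u
    proof -
      have "(\<Sum>b\<in>E. x b * A u b) = (\<Sum>b\<in>E. \<Sum>v\<in>V. A u b * X b v * y v)"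
        by (intro sum.cong refl) (simp add: x_def sum_distrib_left sum_distrib_right mult_ac)
      also have "\<dots> = (\<Sum>v\<in>V. (\<Sum>b\<in>E. A u b * X b v) * y v)"
        by (subst sum.swap) (simp add: sum_distrib_right)
      also have "\<dots> = (\<Sum>v\<in>V. if u = v then y v else 0)"
        by (intro sum.cong refl) (simp add: X1 u)
      also have "\<dots> = y u"
        using u V by simp
      finally show ?thesis .
    qed
    moreover have "x \<in> chains E"
      by (simp add: chains_def x_def)
    ultimately show "\<exists>x\<in>chains E. \<forall>v\<in>V. (\<Sum>b\<in>E. x b * A v b) = y v"
      by (intro bexI[of _ x]) simp_all
  qed
  ultimately show "?inj \<and> ?surj" ..
next
  assume R: "?inj \<and> ?surj"
  have "\<exists>x\<in>chains E. \<forall>v\<in>V. (\<Sum>b\<in>E. x b * A v b) = basis_chain u v" if "u \<in> V" for u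
  proof -
    have "basis_chain u \<in> chains V"
      using that by (auto simp: chains_def basis_chain_def)
    then show ?thesis
      using conjunct2[OF R] by (rule bspec[rotated])
  qed
  then have "\<forall>u\<in>V. \<exists>x. x \<in> chains E \<and> (\<forall>v\<in>V. (\<Sum>b\<in>E. x b * A v b) = basis_chain u v)"
    by blast
  from bchoice[OF this] obtain X where X: "\<And>u. u \<in> V \<Longrightarrow> X u \<in> chains E"
    and AX: "\<And>u v. u \<in> V \<Longrightarrow> v \<in> V \<Longrightarrow> (\<Sum>b\<in>E. X u b * A v b) = basis_chain u v"
    by blast
  have XA: "(\<Sum>u\<in>V. A u c * X u b) = basis_chain c b" if c: "c \<in> E" for b c
  proof -
    define x where "x b = (\<Sum>u\<in>V. A u c * X u b) - basis_chain c b" for b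
    have "x \<in> chains E"
      using X c by (auto simp: x_def chains_def basis_chain_def)
    moreover have "(\<Sum>b\<in>E. x b * A v b) = 0" if v: "v \<in> V" for v
    proof -
      have "(\<Sum>b\<in>E. x b * A v b)
          = (\<Sum>b\<in>E. \<Sum>u\<in>V. A u c * (X u b * A v b)) - (\<Sum>b\<in>E. if b = c then A v b else 0)"
        unfolding sum_subtractf[symmetric]
        by (intro sum.cong refl)
           (simp add: x_def left_diff_distrib sum_distrib_right basis_chain_def mult.assoc)
      also have "(\<Sum>b\<in>E. if b = c then A v b else 0) = A v c"
        using c E by simp
      also have "(\<Sum>b\<in>E. \<Sum>u\<in>V. A u c * (X u b * A v b)) = (\<Sum>u\<in>V. A u c * basis_chain u v)"
        by (subst sum.swap) (simp add: sum_distrib_left[symmetric] AX v)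
      also have "\<dots> = (\<Sum>u\<in>V. if v = u then A u c else 0)"
        by (intro sum.cong) (auto simp: basis_chain_def)
      also have "\<dots> = A v c"
        using v V by simp
      finally show ?thesis
        by simp
    qed
    ultimately have "x = (\<lambda>_. 0)"
      by (intro conjunct1[OF R, rule_format]) simp_all
    then show ?thesis
      unfolding x_def by (simp add: fun_eq_iff)
  qed
  \<comment> \<open>the trace of \<open>X A = 1\<close> is the trace of \<open>A X = 1\<close>\<close>
  have "(of_nat (card E) :: complex) = (\<Sum>c\<in>E. \<Sum>u\<in>V. A u c * X u c)"
    by (simp add: XA basis_chain_def)
  also have "\<dots> = (\<Sum>u\<in>V. \<Sum>c\<in>E. X u c * A u c)"
    by (subst sum.swap) (simp add: mult.commute)
  also have "\<dots> = of_nat (card V)"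
    by (simp add: AX basis_chain_def)
  finally have card: "card E = card V"
    by simp
  have "minor A V E * minor (\<lambda>b u. X u b) E V = minor (\<lambda>v u. \<Sum>b\<in>E. A v b * X u b) V V"
    using minor_mult[OF V E card, of A "\<lambda>b u. X u b" V] by simp
  also have "\<dots> = minor (\<lambda>v u. if v = u then 1 else 0) V V"
    using V AX by (intro minor_cong) (auto simp: basis_chain_def mult.commute)
  also have "\<dots> = 1"
    by (rule minor_identity[OF V])
  finally show ?L
    using card by auto
qed

section \<open>Spanning trees as nonzero minors\<close>

lemma boundary_eq: "boundary G \<rho> x v = (\<Sum>b\<in>arcs G. x b * incidence G \<rho> v b)"
  by (simp add: boundary_def incidence_def)

lemma boundary_in_chains0:
  assumes "wf_digraph G"
  shows "boundary G \<rho> x \<in> chains0 G"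
proof -
  interpret wf_digraph G by fact
  have "incidence G \<rho> v b = 0" if "v \<notin> verts G" "b \<in> arcs G" for v b
    using that tail_in_verts[of b] head_in_verts[of b] by (auto simp: incidence_def basis_chain_def)
  then show ?thesis
    by (simp add: chains_def boundary_eq)
qed

lemma boundary_uminus: "boundary G \<rho> (\<lambda>b. - x b) = (\<lambda>v. - boundary G \<rho> x v)"
  by (simp add: fun_eq_iff boundary_eq sum_negf)

text \<open>
  The zeroth homology vanishes iff all chains are homologous, iff the boundary map is surjective.
\<close>

lemma homologous_total_iff:
  "homologous G \<rho> = chains0 G \<times> chains0 G \<longleftrightarrow> chains0 G \<subseteq> boundary G \<rho> ` chains1 G"
proof
  assume eq: "homologous G \<rho> = chains0 G \<times> chains0 G"
  show "chains0 G \<subseteq> boundary G \<rho> ` chains1 G"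
  proof
    fix y assume "y \<in> chains0 G"
    then have "(y, \<lambda>_. 0) \<in> homologous G \<rho>"
      unfolding eq by (simp add: chains_def)
    then show "y \<in> boundary G \<rho> ` chains1 G"
      by (simp add: homologous_def)
  qed
next
  assume sub: "chains0 G \<subseteq> boundary G \<rho> ` chains1 G"
  have "(\<lambda>v. x v - y v) \<in> boundary G \<rho> ` chains1 G" if "x \<in> chains0 G" "y \<in> chains0 G" for x y
  proof -
    have "(\<lambda>v. x v - y v) \<in> chains0 G"
      using that by (simp add: chains_def)
    with sub show ?thesis ..
  qed
  then show "homologous G \<rho> = chains0 G \<times> chains0 G"
    by (auto simp: homologous_def)
qed

lemma homologous_zero_boundary:
  assumes "homologous G \<rho> `` {y} = homologous G \<rho> `` {\<lambda>_. 0}" and y: "y \<in> chains0 G"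
  shows "y \<in> boundary G \<rho> ` chains1 G"
proof -
  have "boundary G \<rho> (\<lambda>_. 0) \<in> boundary G \<rho> ` chains1 G"
    by (rule imageI) (simp add: chains_def)
  moreover have "boundary G \<rho> (\<lambda>_. 0) = (\<lambda>v. y v - y v)"
    by (simp add: boundary_eq fun_eq_iff)
  ultimately have "(\<lambda>v. y v - y v) \<in> boundary G \<rho> ` chains1 G"
    by (simp only:)
  then have "y \<in> homologous G \<rho> `` {y}"
    using y by (simp add: homologous_def)
  then have "(\<lambda>v. - y v) \<in> boundary G \<rho> ` chains1 G"
    unfolding assms(1) by (simp add: homologous_def)
  then obtain x where x: "(\<lambda>v. - y v) = boundary G \<rho> x" "x \<in> chains1 G"
    by (rule imageE)
  then have "boundary G \<rho> (\<lambda>b. - x b) = y"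
    by (simp add: boundary_uminus x(1)[symmetric])
  moreover have "(\<lambda>b. - x b) \<in> chains1 G"
    using x(2) by (simp add: chains_def)
  ultimately show ?thesis
    by blast
qed

lemma H0_zero_imp_total:
  assumes "H0_zero G \<rho>"
  shows "homologous G \<rho> = chains0 G \<times> chains0 G"
proof -
  have "y \<in> boundary G \<rho> ` chains1 G" if y: "y \<in> chains0 G" for y
  proof (rule homologous_zero_boundary[OF _ y])
    have "homologous G \<rho> `` {y} \<in> H0 G \<rho>"
      using y by (simp add: H0_def quotientI)
    then show "homologous G \<rho> `` {y} = homologous G \<rho> `` {\<lambda>_. 0}"
      using assms by (simp add: H0_zero_def)
  qed
  then show ?thesis
    unfolding homologous_total_iff by blast
qed

lemma H0_if_total:
  assumes "homologous G \<rho> = chains0 G \<times> chains0 G"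
  shows "H0 G \<rho> = {chains0 G}"
proof -
  have "(\<lambda>_. 0) \<in> chains0 G"
    by (simp add: chains_def)
  then show ?thesis
    unfolding H0_def quotient_def assms by auto
qed

text \<open>
  As the target of the inclusion-induced map is trivial, its bijectivity says that the zeroth
  homology of \<open>T\<close> vanishes too.  So the two homological conditions mean that the boundary
  map of \<open>T\<close> is injective and surjective.
\<close>

lemma rho_spanning_tree_iff:
  assumes G: "fin_digraph G" and H0: "H0_zero G \<rho>"
  shows "rho_spanning_tree G \<rho> T \<longleftrightarrow> subgraph T G \<and> verts T = verts G \<and>
    card (arcs T) = card (verts T) \<and> minor (incidence T \<rho>) (verts T) (arcs T) \<noteq> 0"
proof -
  have "H1_zero T \<rho> \<and> bij_betw (H0_incl G \<rho>) (H0 T \<rho>) (H0 G \<rho>) \<longleftrightarrow>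
    card (arcs T) = card (verts T) \<and> minor (incidence T \<rho>) (verts T) (arcs T) \<noteq> 0"
    if T: "subgraph T G" "verts T = verts G"
  proof -
    interpret G: fin_digraph G by fact
    have wf: "wf_digraph T" and "arcs T \<subseteq> arcs G"
      using T(1) by (simp_all add: subgraph_def)
    then have fin: "finite (arcs T)" "finite (verts T)"
      using T(2) finite_subset[OF _ G.finite_arcs] by simp_all
    have ext: "boundary T \<rho> x = y \<longleftrightarrow> (\<forall>v\<in>verts T. (\<Sum>b\<in>arcs T. x b * incidence T \<rho> v b) = y v)"
      if "y \<in> chains0 T" for x y
      using boundary_in_chains0[OF wf, of \<rho> x] that
      unfolding fun_eq_iff boundary_eq[symmetric] chains_def mem_Collect_eq by metis
    have zero: "(\<lambda>_. 0) \<in> chains0 T" "(\<lambda>_. 0) \<in> chains1 T" "boundary T \<rho> (\<lambda>_. 0) = (\<lambda>_. 0)"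
      by (simp_all add: chains_def boundary_eq fun_eq_iff)
    have tot_G: "homologous G \<rho> = chains0 T \<times> chains0 T"
      using H0_zero_imp_total[OF H0] T(2) by simp
    have H0_G: "H0 G \<rho> = {chains0 T}"
      using H0_if_total[OF H0_zero_imp_total[OF H0]] T(2) by simp
    have "H1_zero T \<rho> \<longleftrightarrow> (\<forall>x\<in>chains1 T. boundary T \<rho> x = (\<lambda>_. 0) \<longrightarrow> x = (\<lambda>_. 0))"
      using zero unfolding H1_zero_def H1_def by auto
    also have "\<dots> \<longleftrightarrow> (\<forall>x\<in>chains1 T. (\<forall>v\<in>verts T. (\<Sum>b\<in>arcs T. x b * incidence T \<rho> v b) = 0) \<longrightarrow> x = (\<lambda>_. 0))"
      by (simp only: ext[OF zero(1)])
    finally have H1: "H1_zero T \<rho> \<longleftrightarrow> \<dots>" .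
    have "bij_betw (H0_incl G \<rho>) (H0 T \<rho>) (H0 G \<rho>) \<longleftrightarrow> chains0 T \<subseteq> boundary T \<rho> ` chains1 T"
    proof
      assume bij: "bij_betw (H0_incl G \<rho>) (H0 T \<rho>) (H0 G \<rho>)"
      show "chains0 T \<subseteq> boundary T \<rho> ` chains1 T"
      proof
        fix y assume y: "y \<in> chains0 T"
        have cl: "homologous T \<rho> `` {y} \<in> H0 T \<rho>" "homologous T \<rho> `` {\<lambda>_. 0} \<in> H0 T \<rho>"
          using y zero(1) by (simp_all add: H0_def quotientI)
        then have "H0_incl G \<rho> (homologous T \<rho> `` {y}) = H0_incl G \<rho> (homologous T \<rho> `` {\<lambda>_. 0})"
          using bij_betw_apply[OF bij] unfolding H0_G by simp
        then have "homologous T \<rho> `` {y} = homologous T \<rho> `` {\<lambda>_. 0}"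
          using bij_betw_imp_inj_on[OF bij] cl by (simp add: inj_on_eq_iff)
        then show "y \<in> boundary T \<rho> ` chains1 T"
          using y by (rule homologous_zero_boundary)
      qed
    next
      assume "chains0 T \<subseteq> boundary T \<rho> ` chains1 T"
      then have "homologous T \<rho> = chains0 T \<times> chains0 T"
        by (simp only: homologous_total_iff)
      then have "H0 T \<rho> = {chains0 T}"
        by (rule H0_if_total)
      moreover have "H0_incl G \<rho> (chains0 T) = chains0 T"
        unfolding H0_incl_def tot_G using zero(1) by auto
      ultimately show "bij_betw (H0_incl G \<rho>) (H0 T \<rho>) (H0 G \<rho>)"
        unfolding H0_G by (simp add: bij_betw_def)
    qed
    also have "\<dots> \<longleftrightarrow> (\<forall>y\<in>chains0 T. \<exists>x\<in>chains1 T. boundary T \<rho> x = y)"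
      by (auto simp: image_iff subset_iff)
    also have "\<dots> \<longleftrightarrow> (\<forall>y\<in>chains0 T. \<exists>x\<in>chains1 T. \<forall>v\<in>verts T. (\<Sum>b\<in>arcs T. x b * incidence T \<rho> v b) = y v)"
      using ext by simp
    finally have "bij_betw (H0_incl G \<rho>) (H0 T \<rho>) (H0 G \<rho>) \<longleftrightarrow> \<dots>" .
    with H1 show ?thesis
      using minor_neq_0_iff_bijective[OF fin(2,1), of "incidence T \<rho>"] by simp
  qed
  then show ?thesis
    unfolding rho_spanning_tree_def by blast
qed

lemma rho_hat_spanning_subgraph:
  assumes T: "fin_digraph T" and \<rho>: "\<And>b. b \<in> arcs T \<Longrightarrow> cmod (\<rho> b) = 1"
    and card: "card (arcs T) = card (verts T)"
    and nz: "minor (incidence T \<rho>) (verts T) (arcs T) \<noteq> 0"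
  shows "rho_hat \<rho> T =
    minor (incidence T \<rho>) (verts T) (arcs T) * cnj (minor (incidence T \<rho>) (verts T) (arcs T))"
proof -
  interpret fin_digraph T by fact
  obtain f where f: "bij_betw f (verts T) (arcs T)"
    and nz_f: "\<And>v. v \<in> verts T \<Longrightarrow> incidence T \<rho> v (f v) \<noteq> 0"
    by (rule minor_neq_0_imp_matching[OF finite_verts finite_arcs card[symmetric] nz])
       (rule that, assumption+)
  interpret vertex_arc_matching T f
  proof
    fix v assume "v \<in> verts T"
    then show "tail T (f v) = v \<or> head T (f v) = v"
      using nz_f[of v] by (auto simp: incidence_def basis_chain_def split: if_splits)
  qed (rule f)
  show ?thesis
    using minor_incidence[OF \<rho>] by simp
qed

section \<open>The determinant as a sum over spanning trees\<close>

text \<open>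
  The description of the adjoint in \<^const>\<open>boundary_adj\<close> determines its values: testing
  against the basis chain of an arc \<open>b\<close> isolates the coefficient at \<open>b\<close>.
\<close>

lemma boundary_adj_basis_chain:
  assumes "fin_digraph G" and v: "v \<in> verts G"
  shows "boundary_adj G \<rho> (basis_chain v) = (\<lambda>b. if b \<in> arcs G then cnj (incidence G \<rho> v b) else 0)"
    (is "_ = ?x")
proof -
  interpret fin_digraph G by fact
  have adj: "herm_inner (verts G) (boundary G \<rho> z) (basis_chain v) = herm_inner (arcs G) z ?x" for z
  proof -
    have "herm_inner (verts G) (boundary G \<rho> z) (basis_chain v)
        = (\<Sum>u\<in>verts G. if u = v then boundary G \<rho> z u else 0)"
      unfolding herm_inner_def by (intro sum.cong) (auto simp: basis_chain_def)
    also have "\<dots> = herm_inner (arcs G) z ?x"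
      using v by (simp add: herm_inner_def boundary_eq)
    finally show ?thesis .
  qed
  show ?thesis
    unfolding boundary_adj_def
  proof (rule the_equality)
    show "?x \<in> chains1 G \<and> (\<forall>z\<in>chains1 G.
        herm_inner (verts G) (boundary G \<rho> z) (basis_chain v) = herm_inner (arcs G) z ?x)"
      using adj by (simp add: chains_def)
  next
    fix x assume x: "x \<in> chains1 G \<and> (\<forall>z\<in>chains1 G.
        herm_inner (verts G) (boundary G \<rho> z) (basis_chain v) = herm_inner (arcs G) z x)"
    show "x = ?x"
    proof
      fix b
      show "x b = ?x b"
      proof (cases "b \<in> arcs G")
        case True
        have inner: "herm_inner (arcs G) (basis_chain b) y = cnj (y b)" for y
        proof -
          have "herm_inner (arcs G) (basis_chain b) y = (\<Sum>c\<in>arcs G. if c = b then cnj (y c) else 0)"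
            unfolding herm_inner_def by (intro sum.cong) (auto simp: basis_chain_def)
          then show ?thesis
            using True by simp
        qed
        have "basis_chain b \<in> chains1 G"
          using True by (auto simp: chains_def basis_chain_def)
        then have "herm_inner (arcs G) (basis_chain b) x = herm_inner (arcs G) (basis_chain b) ?x"
          using x adj by metis
        then show ?thesis
          unfolding inner by simp
      qed (use x in \<open>simp add: chains_def\<close>)
    qed
  qed
qed

lemma minor_cnj: "minor (\<lambda>x y. cnj (A x y)) R C = cnj (minor A R C)"
  by (simp add: minor_leibniz)

lemma endo_det_laplacian:
  assumes G: "fin_digraph G"
  shows "endo_det (verts G) (\<lambda>x. boundary G \<rho> (boundary_adj G \<rho> x)) =
    (\<Sum>S | S \<subseteq> arcs G \<and> card S = card (verts G).
      minor (incidence G \<rho>) (verts G) S * cnj (minor (incidence G \<rho>) (verts G) S))"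
proof -
  interpret fin_digraph G by fact
  let ?V = "verts G" and ?I = "incidence G \<rho>"
  have "endo_det ?V (\<lambda>x. boundary G \<rho> (boundary_adj G \<rho> x))
      = minor (\<lambda>u v. boundary G \<rho> (boundary_adj G \<rho> (basis_chain v)) u) ?V ?V"
    by (simp add: endo_det_def minor_def)
  also have "\<dots> = minor (\<lambda>u v. \<Sum>b\<in>arcs G. ?I u b * cnj (?I v b)) ?V ?V"
    by (intro minor_cong) (simp_all add: boundary_adj_basis_chain[OF G] boundary_eq mult.commute)
  also have "\<dots> = (\<Sum>S | S \<subseteq> arcs G \<and> card S = card ?V. minor ?I ?V S * minor (\<lambda>b v. cnj (?I v b)) S ?V)"
    by (rule cauchy_binet) simp_all
  also have "\<dots> = (\<Sum>S | S \<subseteq> arcs G \<and> card S = card ?V. minor ?I ?V S * cnj (minor ?I ?V S))"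
  proof (intro sum.cong refl)
    fix S assume "S \<in> {S. S \<subseteq> arcs G \<and> card S = card ?V}"
    then have "card ?V = card S"
      by simp
    from minor_transpose[OF this, of "\<lambda>v b. cnj (?I v b)"]
    show "minor ?I ?V S * minor (\<lambda>b v. cnj (?I v b)) S ?V = minor ?I ?V S * cnj (minor ?I ?V S)"
      by (simp add: minor_cnj)
  qed
  finally show ?thesis .
qed

theorem corollary4:
  fixes G :: "('v, 'e) pre_digraph" and \<rho> :: "'e \<Rightarrow> complex"
  assumes "fin_digraph G"
    and "Digraph_Component.connected G"
    and "line_bundle G \<rho>"
    and "H0_zero G \<rho>"
  shows "endo_det (verts G) (\<lambda>x. boundary G \<rho> (boundary_adj G \<rho> x)) =
         (\<Sum>T | rho_spanning_tree G \<rho> T. rho_hat \<rho> T)"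
proof -
  interpret fin_digraph G by fact
  let ?V = "verts G"
  let ?m = "\<lambda>S. minor (incidence G \<rho>) ?V S"
  \<comment> \<open>spanning subgraphs correspond to their sets of arcs\<close>
  let ?T = "\<lambda>S. G\<lparr>arcs := S\<rparr>"
  let ?\<S> = "{S. S \<subseteq> arcs G \<and> card S = card ?V \<and> ?m S \<noteq> 0}"
  have inc: "incidence (?T S) \<rho> = incidence G \<rho>" for S
    by (simp add: incidence_def fun_eq_iff)
  have sub: "subgraph (?T S) G" if "S \<subseteq> arcs G" for S
    using that wf_digraph_axioms by (auto simp: subgraph_def wf_digraph_def compatible_def)
  have T_eq: "T = ?T (arcs T)" "arcs T \<subseteq> arcs G" if "subgraph T G" "verts T = ?V" for T
    using that by (auto simp: subgraph_def compatible_def)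
  have "endo_det ?V (\<lambda>x. boundary G \<rho> (boundary_adj G \<rho> x)) =
      (\<Sum>S | S \<subseteq> arcs G \<and> card S = card ?V. ?m S * cnj (?m S))"
    by (rule endo_det_laplacian) fact
  also have "\<dots> = (\<Sum>S\<in>?\<S>. ?m S * cnj (?m S))"
    by (intro sum.mono_neutral_right) (auto intro: finite_subset[of _ "Pow (arcs G)"])
  also have "\<dots> = (\<Sum>T | rho_spanning_tree G \<rho> T. rho_hat \<rho> T)"
  proof (rule sum.reindex_bij_witness[of _ arcs ?T])
    fix T assume "T \<in> {T. rho_spanning_tree G \<rho> T}"
    then have T: "subgraph T G" "verts T = ?V" "card (arcs T) = card (verts T)"
      "minor (incidence T \<rho>) (verts T) (arcs T) \<noteq> 0"
      using rho_spanning_tree_iff[OF assms(1,4)] by auto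
    show eq: "?T (arcs T) = T"
      using T_eq(1)[OF T(1,2)] by simp
    have "incidence T \<rho> = incidence G \<rho>"
      using inc[of "arcs T"] unfolding eq .
    then show "arcs T \<in> ?\<S>"
      using T T_eq(2) by auto
  next
    fix S assume S: "S \<in> ?\<S>"
    show "arcs (?T S) = S"
      by simp
    have nz: "minor (incidence (?T S) \<rho>) (verts (?T S)) (arcs (?T S)) \<noteq> 0"
      using S by (simp add: inc)
    then show "?T S \<in> {T. rho_spanning_tree G \<rho> T}"
      using S sub rho_spanning_tree_iff[OF assms(1,4), of "?T S"] by simp
    have "wf_digraph (?T S)"
      using S sub by (auto simp: subgraph_def)
    moreover have "finite S"
      using S finite_subset[OF _ finite_arcs] by blast
    ultimately have "fin_digraph (?T S)"
      by (simp add: fin_digraph_def fin_digraph_axioms_def)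
    then have "rho_hat \<rho> (?T S) = minor (incidence (?T S) \<rho>) (verts (?T S)) (arcs (?T S))
        * cnj (minor (incidence (?T S) \<rho>) (verts (?T S)) (arcs (?T S)))"
      using S nz assms(3) by (intro rho_hat_spanning_subgraph) (auto simp: line_bundle_def)
    then show "rho_hat \<rho> (?T S) = ?m S * cnj (?m S)"
      by (simp add: inc)
  qed
  finally show ?thesis .
qed

end
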